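(* Let $\Gamma\Subset\Omega^\circ$ with $\Omega\subset\mathbb R^d$ compact. Suppose the continuity-reaction equation driven by $(v_t,\beta_t)_{t\in[0,1]}$ is uniquely solved (among weakly continuous distributional solutions with initial datum $\mu_0$) by a weakly continuous $\mathrm{HK}$ geodesic $(\mu_t)_{t\in[0,1]}$ in $\mathfrak M_+^\Gamma(\Omega)$. Assume that $v_t$ is uniformly bounded on $[0,1]\times\Omega$ and admits a flow $X_t$, i.e. $\partial_tX_t(x)=v_t(X_t(x))$, $X_0(x)=x$, that is $\mu_0$-a.e. injective for all $t$; that $s\mapsto\beta_s(X_s(x))$ is in $L^1(0,1)$ for $\mu_0$-a.e. $x$; and that $\beta_s\le\beta_{\max}<\infty$. Define $\eta_t:=(X_t)_\#\mu_0$ and assume that for each $t$ there exists a measurable map $r_t:\Omega\to(0,\infty)$, unique $\eta_t$-a.e., such that $$r_t(X_t(x))=\exp\left(2\int_0^t\beta_s(X_s(x))\,ds\right)\quad\mu_0\text{-a.e.}$$ Then for every Borel $A\subset\Omega$, $$\mu_t(A)=\int_Ar_t^2\,d\eta_t,$$ and $\lambda_t:=(x\mapsto(x,r_t(x)))_\#\eta_t$ is a valid lift of $\mu_t$, i.e. $\mu_t=\mathfrak P\lambda_t$.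
   Context: $\mathfrak M_+(\Omega)$: finite nonnegative Radon measures on $\Omega$; $\mathfrak M_+^\Gamma(\Omega)$: those supported in $\Gamma$. A curve of measures is weakly continuous if $t\mapsto\int f\,d\mu_t$ is continuous for every bounded continuous $f$. Continuity-reaction equation $\partial_t\mu_t+\nabla\cdot(\mu_tv_t)=4\beta_t\mu_t$ in the distributional sense: $\int_0^1\int_\Omega(\partial_t\varphi+\langle\nabla\varphi,v_t\rangle+4\beta_t\varphi)\,d\mu_t\,dt=0$ for all bounded Lipschitz $\varphi\in C_c^1((0,1)\times\Omega)$. $\mathrm{HK}^2(\mu_0,\mu_1)=\inf\int_0^1(\|v_t\|^2_{L^2(\mu_t)}+4\|\beta_t\|^2_{L^2(\mu_t)})dt$ over weakly continuous distributional solutions $(\mu_t,v_t,\beta_t)$ of the continuity-reaction equation joining $\mu_0$ to $\mu_1$; an HK geodesic is a curve with $\mathrm{HK}(\mu_s,\mu_t)=|t-s|\mathrm{HK}(\mu_0,\mu_1)$. Cone: $\mathfrak C_\Omega=(\Omega\times[0,\infty))/(\Omega\times\{0\})$, points $(x,r)$. For a finite nonnegative Radon measure $\lambda$ on $\mathfrak C_\Omega$ with $\int r^2d\lambda<\infty$, $\mathfrak P\lambda$ is the measure on $\Omega$ with $\int_\Omega\phi\,d\mathfrak P\lambda=\int_{\mathfrak C_\Omega}r^2\phi(x)\,d\lambda(x,r)$ for all $\phi\in C^0(\Omega)$. *)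

theory Defs
  imports "HOL-Analysis.Analysis"
begin

section \<open>Measures on a compact set\<close>

abbreviation borel_on :: "'a::topological_space set \<Rightarrow> 'a measure" where
  "borel_on \<Omega> \<equiv> restrict_space borel \<Omega>"

text \<open>
  Inner regularity is not required separately: a finite Borel measure on a compact subset of a
  Euclidean space is a Radon measure.
\<close>

definition fin_radon :: "'a::euclidean_space set \<Rightarrow> 'a measure set" where
  "fin_radon \<Omega> = {\<mu>. sets \<mu> = sets (borel_on \<Omega>) \<and> finite_measure \<mu>}"

definition msupport :: "'a::euclidean_space set \<Rightarrow> 'a measure \<Rightarrow> 'a set" where
  "msupport \<Omega> \<mu> = {x \<in> \<Omega>. \<forall>U. open U \<longrightarrow> x \<in> U \<longrightarrow> emeasure \<mu> (U \<inter> \<Omega>) > 0}"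

definition fin_radon_supp :: "'a::euclidean_space set \<Rightarrow> 'a set \<Rightarrow> 'a measure set" where
  "fin_radon_supp \<Omega> \<Gamma> = {\<mu> \<in> fin_radon \<Omega>. msupport \<Omega> \<mu> \<subseteq> \<Gamma>}"

definition compactly_inside :: "'a::euclidean_space set \<Rightarrow> 'a set \<Rightarrow> bool" where
  "compactly_inside \<Gamma> U \<longleftrightarrow> compact (closure \<Gamma>) \<and> closure \<Gamma> \<subseteq> U"

definition weakly_continuous :: "'a::euclidean_space set \<Rightarrow> (real \<Rightarrow> 'a measure) \<Rightarrow> bool" where
  "weakly_continuous \<Omega> \<mu> \<longleftrightarrow>
     (\<forall>f :: 'a \<Rightarrow> real. continuous_on \<Omega> f \<longrightarrow> bounded (f ` \<Omega>) \<longrightarrow>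
        continuous_on {0..1} (\<lambda>t. \<integral>x. f x \<partial>\<mu> t))"


section \<open>The continuity-reaction equation\<close>

definition grad :: "('a::euclidean_space \<Rightarrow> real) \<Rightarrow> 'a \<Rightarrow> 'a" where
  "grad f x = (THE D. GDERIV f x :> D)"

lemma grad_eqI:
  assumes "GDERIV f x :> D"
  shows "grad f x = D"
  unfolding grad_def
proof (rule the_equality)
  show "GDERIV f x :> D" by fact
next
  fix E assume "GDERIV f x :> E"
  then have "(\<lambda>h. inner h E) = (\<lambda>h. inner h D)"
    using assms has_derivative_unique unfolding gderiv_def by blast
  then have "inner (E - D) E = inner (E - D) D"
    by metis
  then show "E = D"
    by (metis inner_diff_right inner_eq_zero_iff right_minus_eq)
qed

definition C1 :: "('a::euclidean_space \<Rightarrow> real) \<Rightarrow> bool" where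
  "C1 \<phi> \<longleftrightarrow>
     (\<exists>D. (\<forall>z. (\<phi> has_derivative blinfun_apply (D z)) (at z)) \<and> continuous_on UNIV D)"

text \<open>
  The set \<^term>\<open>\<Omega>\<close> is compact, so \<open>C\<^sup>1\<close> on \<open>(0,1) \<times> \<Omega>\<close> means: restriction of a \<open>C\<^sup>1\<close> function of
  the whole space. The support is compact as a subset of \<open>(0,1) \<times> \<Omega>\<close>: test functions vanish near
  the times 0 and 1, but they need not vanish on the boundary of \<^term>\<open>\<Omega>\<close> (no-flux condition).
\<close>

definition test_function :: "'a::euclidean_space set \<Rightarrow> (real \<times> 'a \<Rightarrow> real) \<Rightarrow> bool" where
  "test_function \<Omega> \<phi> \<longleftrightarrow>
     C1 \<phi> \<and>
     (\<exists>K. compact K \<and> K \<subseteq> {0<..<1} \<times> \<Omega> \<and> (\<forall>z \<in> {0<..<1} \<times> \<Omega> - K. \<phi> z = 0)) \<and>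
     bounded (\<phi> ` ({0<..<1} \<times> \<Omega>)) \<and>
     (\<exists>L. L-lipschitz_on ({0<..<1} \<times> \<Omega>) \<phi>)"

definition cre_integrand ::
  "(real \<Rightarrow> 'a::euclidean_space \<Rightarrow> 'a) \<Rightarrow> (real \<Rightarrow> 'a \<Rightarrow> real) \<Rightarrow> (real \<times> 'a \<Rightarrow> real) \<Rightarrow>
   real \<Rightarrow> 'a \<Rightarrow> real" where
  "cre_integrand v \<beta> \<phi> t x =
     deriv (\<lambda>s. \<phi> (s, x)) t + inner (grad (\<lambda>y. \<phi> (t, y)) x) (v t x) + 4 * \<beta> t x * \<phi> (t, x)"

text \<open>
  The finiteness condition states that the integrand is absolutely integrable with respect to
  \<open>d\<mu>\<^sub>t dt\<close>, so that the equation does not hold merely by the convention that the Bochner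
  integral of a non-integrable function is 0.
\<close>

definition cre_distributional ::
  "'a::euclidean_space set \<Rightarrow> (real \<Rightarrow> 'a measure) \<Rightarrow> (real \<Rightarrow> 'a \<Rightarrow> 'a) \<Rightarrow> (real \<Rightarrow> 'a \<Rightarrow> real) \<Rightarrow> bool"
  where
  "cre_distributional \<Omega> \<mu> v \<beta> \<longleftrightarrow>
     (\<forall>\<phi>. test_function \<Omega> \<phi> \<longrightarrow>
        (\<integral>\<^sup>+t\<in>{0<..<1}. (\<integral>\<^sup>+x. ennreal \<bar>cre_integrand v \<beta> \<phi> t x\<bar> \<partial>\<mu> t) \<partial>lborel) < \<infinity> \<and>
        (LBINT t:{0<..<1}. (\<integral>x. cre_integrand v \<beta> \<phi> t x \<partial>\<mu> t)) = 0)"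

definition borel_fields ::
  "'a::euclidean_space set \<Rightarrow> (real \<Rightarrow> 'a \<Rightarrow> 'a) \<Rightarrow> (real \<Rightarrow> 'a \<Rightarrow> real) \<Rightarrow> bool" where
  "borel_fields \<Omega> v \<beta> \<longleftrightarrow>
     (\<lambda>(t, x). v t x) \<in> borel_measurable (borel_on ({0..1} \<times> \<Omega>)) \<and>
     (\<lambda>(t, x). \<beta> t x) \<in> borel_measurable (borel_on ({0..1} \<times> \<Omega>))"

definition cre_solution ::
  "'a::euclidean_space set \<Rightarrow> (real \<Rightarrow> 'a measure) \<Rightarrow> (real \<Rightarrow> 'a \<Rightarrow> 'a) \<Rightarrow> (real \<Rightarrow> 'a \<Rightarrow> real) \<Rightarrow> bool"
  where
  "cre_solution \<Omega> \<mu> v \<beta> \<longleftrightarrow>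
     borel_fields \<Omega> v \<beta> \<and>
     (\<forall>t\<in>{0..1}. \<mu> t \<in> fin_radon \<Omega>) \<and>
     weakly_continuous \<Omega> \<mu> \<and>
     cre_distributional \<Omega> \<mu> v \<beta>"


section \<open>The Hellinger-Kantorovich distance\<close>

definition HK_action ::
  "(real \<Rightarrow> 'a::euclidean_space measure) \<Rightarrow> (real \<Rightarrow> 'a \<Rightarrow> 'a) \<Rightarrow> (real \<Rightarrow> 'a \<Rightarrow> real) \<Rightarrow> ennreal"
  where
  "HK_action \<mu> v \<beta> =
     (\<integral>\<^sup>+t\<in>{0..1}. ((\<integral>\<^sup>+x. ennreal ((norm (v t x))\<^sup>2) \<partial>\<mu> t)
                  + 4 * (\<integral>\<^sup>+x. ennreal ((\<beta> t x)\<^sup>2) \<partial>\<mu> t)) \<partial>lborel)"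

definition HK_sq :: "'a::euclidean_space set \<Rightarrow> 'a measure \<Rightarrow> 'a measure \<Rightarrow> ennreal" where
  "HK_sq \<Omega> \<nu>\<^sub>0 \<nu>\<^sub>1 =
     Inf {HK_action \<mu> v \<beta> | \<mu> v \<beta>. cre_solution \<Omega> \<mu> v \<beta> \<and> \<mu> 0 = \<nu>\<^sub>0 \<and> \<mu> 1 = \<nu>\<^sub>1}"

definition HK :: "'a::euclidean_space set \<Rightarrow> 'a measure \<Rightarrow> 'a measure \<Rightarrow> ennreal" where
  "HK \<Omega> \<nu>\<^sub>0 \<nu>\<^sub>1 =
     (if HK_sq \<Omega> \<nu>\<^sub>0 \<nu>\<^sub>1 = \<infinity> then \<infinity> else ennreal (sqrt (enn2real (HK_sq \<Omega> \<nu>\<^sub>0 \<nu>\<^sub>1))))"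

definition HK_geodesic :: "'a::euclidean_space set \<Rightarrow> (real \<Rightarrow> 'a measure) \<Rightarrow> bool" where
  "HK_geodesic \<Omega> \<mu> \<longleftrightarrow>
     (\<forall>s\<in>{0..1}. \<forall>t\<in>{0..1}. HK \<Omega> (\<mu> s) (\<mu> t) = ennreal \<bar>t - s\<bar> * HK \<Omega> (\<mu> 0) (\<mu> 1))"


section \<open>The cone\<close>

definition cone_rel :: "'a set \<Rightarrow> (('a \<times> real) \<times> ('a \<times> real)) set" where
  "cone_rel \<Omega> = {(p, q). p \<in> \<Omega> \<times> {0..} \<and> q \<in> \<Omega> \<times> {0..} \<and> (p = q \<or> snd p = 0 \<and> snd q = 0)}"

definition cone :: "'a set \<Rightarrow> ('a \<times> real) set set" where
  "cone \<Omega> = (\<Omega> \<times> {0..}) // cone_rel \<Omega>"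

definition cone_pt :: "'a set \<Rightarrow> 'a \<times> real \<Rightarrow> ('a \<times> real) set" where
  "cone_pt \<Omega> p = cone_rel \<Omega> `` {p}"

definition cone_topology :: "'a::topological_space set \<Rightarrow> ('a \<times> real) set topology" where
  "cone_topology \<Omega> =
     topology (\<lambda>U. U \<subseteq> cone \<Omega> \<and> openin (top_of_set (\<Omega> \<times> {0..})) {p \<in> \<Omega> \<times> {0..}. cone_pt \<Omega> p \<in> U})"

definition cone_borel :: "'a::topological_space set \<Rightarrow> ('a \<times> real) set measure" where
  "cone_borel \<Omega> = sigma (cone \<Omega>) {U. openin (cone_topology \<Omega>) U}"

text \<open>
  Coordinates of a cone point. At the apex the base coordinate is an arbitrary choice; it is
  used below only with the weight \<open>r\<^sup>2 = 0\<close>.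
\<close>

definition cone_base :: "('a \<times> real) set \<Rightarrow> 'a" where
  "cone_base c = fst (SOME p. p \<in> c)"

definition cone_radius :: "('a \<times> real) set \<Rightarrow> real" where
  "cone_radius c = snd (SOME p. p \<in> c)"

lemma equiv_cone_rel: "equiv (\<Omega> \<times> {0..}) (cone_rel \<Omega>)"
  by (intro equivI) (auto simp: cone_rel_def refl_on_def sym_def trans_def)

lemma cone_pt_in_cone: "p \<in> \<Omega> \<times> {0..} \<Longrightarrow> cone_pt \<Omega> p \<in> cone \<Omega>"
  by (simp only: cone_def cone_pt_def quotientI)

lemma openin_cone_topology:
  "openin (cone_topology \<Omega>) U \<longleftrightarrow>
     U \<subseteq> cone \<Omega> \<and> openin (top_of_set (\<Omega> \<times> {0..})) {p \<in> \<Omega> \<times> {0..}. cone_pt \<Omega> p \<in> U}"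
proof -
  let ?P = "\<lambda>U. {p \<in> \<Omega> \<times> {0..}. cone_pt \<Omega> p \<in> U}"
  have int: "?P (S \<inter> T) = ?P S \<inter> ?P T" for S T by auto
  have un: "?P (\<Union>\<K>) = (\<Union>S\<in>\<K>. ?P S)" for \<K> by auto
  have "istopology (\<lambda>U. U \<subseteq> cone \<Omega> \<and> openin (top_of_set (\<Omega> \<times> {0..})) (?P U))"
    unfolding istopology_def int un by (blast intro: openin_Int)
  then show ?thesis
    unfolding cone_topology_def by (simp add: topology_inverse')
qed

lemma topspace_cone_topology: "topspace (cone_topology \<Omega>) = cone \<Omega>"
proof -
  have "openin (cone_topology \<Omega>) (cone \<Omega>)"
    unfolding openin_cone_topology
    by (metis (mono_tags, lifting) Collect_cong Collect_mem_eq cone_pt_in_cone openin_topspace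
        order_refl topspace_euclidean_subtopology)
  then show ?thesis
    by (meson openin_cone_topology openin_subset openin_topspace subset_antisym)
qed

lemma quotient_map_cone_pt:
  "quotient_map (top_of_set (\<Omega> \<times> {0..})) (cone_topology \<Omega>) (cone_pt \<Omega>)"
  unfolding quotient_map_def topspace_cone_topology topspace_euclidean_subtopology
  by (auto simp: openin_cone_topology cone_pt_in_cone)
     (auto simp: cone_def cone_pt_def elim!: quotientE)

lemma cone_coordinates:
  assumes "p \<in> \<Omega> \<times> {0..}"
  shows "cone_radius (cone_pt \<Omega> p) = snd p"
    and "snd p > 0 \<Longrightarrow> cone_base (cone_pt \<Omega> p) = fst p"
proof -
  define q where "q = (SOME q. q \<in> cone_pt \<Omega> p)"
  have "q \<in> cone_pt \<Omega> p"
    unfolding q_def by (rule someI[of _ p]) (use assms in \<open>auto simp: cone_pt_def cone_rel_def\<close>)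
  then have "p = q \<or> snd p = 0 \<and> snd q = 0"
    by (auto simp: cone_pt_def cone_rel_def)
  then show "cone_radius (cone_pt \<Omega> p) = snd p"
    and "snd p > 0 \<Longrightarrow> cone_base (cone_pt \<Omega> p) = fst p"
    unfolding cone_radius_def cone_base_def q_def[symmetric] by auto
qed

text \<open>
  As on \<^term>\<open>\<Omega>\<close>, finite Borel measures on the cone over a compact set are automatically Radon.
\<close>

definition cone_measures :: "'a::euclidean_space set \<Rightarrow> ('a \<times> real) set measure set" where
  "cone_measures \<Omega> =
     {lam. sets lam = sets (cone_borel \<Omega>) \<and> finite_measure lam \<and>
           (\<integral>\<^sup>+c. ennreal ((cone_radius c)\<^sup>2) \<partial>lam) < \<infinity>}"

definition cone_proj :: "'a::euclidean_space set \<Rightarrow> ('a \<times> real) set measure \<Rightarrow> 'a measure" where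
  "cone_proj \<Omega> lam =
     (THE \<mu>. \<mu> \<in> fin_radon \<Omega> \<and>
        (\<forall>\<phi> :: 'a \<Rightarrow> real. continuous_on \<Omega> \<phi> \<longrightarrow>
           (\<integral>x. \<phi> x \<partial>\<mu>) = (\<integral>c. (cone_radius c)\<^sup>2 * \<phi> (cone_base c) \<partial>lam)))"

definition is_lift :: "'a::euclidean_space set \<Rightarrow> ('a \<times> real) set measure \<Rightarrow> 'a measure \<Rightarrow> bool" where
  "is_lift \<Omega> lam \<mu> \<longleftrightarrow> lam \<in> cone_measures \<Omega> \<and> \<mu> = cone_proj \<Omega> lam"


section \<open>Flows and growth factors\<close>

definition is_flow :: "'a::euclidean_space set \<Rightarrow> (real \<Rightarrow> 'a \<Rightarrow> 'a) \<Rightarrow> (real \<Rightarrow> 'a \<Rightarrow> 'a) \<Rightarrow> bool" where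
  "is_flow \<Omega> v X \<longleftrightarrow>
     (\<forall>t\<in>{0..1}. X t \<in> measurable (borel_on \<Omega>) (borel_on \<Omega>)) \<and>
     (\<forall>x\<in>\<Omega>. X 0 x = x) \<and>
     (\<forall>x\<in>\<Omega>. \<forall>t\<in>{0..1}.
        ((\<lambda>s. X s x) has_vector_derivative v t (X t x)) (at t within {0..1}))"

definition ae_injective :: "'a measure \<Rightarrow> ('a \<Rightarrow> 'b) \<Rightarrow> bool" where
  "ae_injective M f \<longleftrightarrow> (\<exists>N \<in> null_sets M. inj_on f (space M - N))"

definition growth_factor ::
  "'a::euclidean_space set \<Rightarrow> 'a measure \<Rightarrow> (real \<Rightarrow> 'a \<Rightarrow> 'a) \<Rightarrow> (real \<Rightarrow> 'a \<Rightarrow> real) \<Rightarrow>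
   real \<Rightarrow> ('a \<Rightarrow> real) \<Rightarrow> bool" where
  "growth_factor \<Omega> \<mu>\<^sub>0 X \<beta> t \<rho> \<longleftrightarrow>
     \<rho> \<in> borel_measurable (borel_on \<Omega>) \<and> (\<forall>x\<in>\<Omega>. \<rho> x > 0) \<and>
     (AE x in \<mu>\<^sub>0. \<rho> (X t x) = exp (2 * (LBINT s:{0..t}. \<beta> s (X s x))))"

end

theory Submission
  imports Defs
begin

text \<open>
  Let \<open>m\<^sub>t(x) = exp (4 \<integral>\<^sub>0\<^sup>t \<beta>\<^sub>s(X\<^sub>s(x)) ds)\<close>, which is \<open>r\<^sub>t(X\<^sub>t(x))\<^sup>2\<close> almost everywhere, and let \<open>\<nu>\<^sub>t\<close> be
  the push-forward of \<open>m\<^sub>t \<mu>\<^sub>0\<close> under \<open>X\<^sub>t\<close>, that is \<open>r\<^sub>t\<^sup>2 \<eta>\<^sub>t\<close>. For a test function \<open>\<phi>\<close> and almost every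
  \<open>x\<close>, the function \<open>t \<mapsto> \<phi>(t, X\<^sub>t(x)) m\<^sub>t(x)\<close> is absolutely continuous, it vanishes at 0 and 1, and its
  derivative is \<open>m\<^sub>t(x)\<close> times the integrand of the continuity-reaction equation at \<open>(t, X\<^sub>t(x))\<close>.
  Integrating over \<open>x\<close> shows that \<open>\<nu>\<close> solves the equation with initial datum \<open>\<mu>\<^sub>0\<close>, hence \<open>\<nu> = \<mu>\<close>.
  The upper bound on \<open>\<beta>\<close> bounds \<open>m\<close>, and also the integral of \<open>\<bar>\<beta>\<bar> m\<close> along the flow, because
  \<open>\<integral> 4 \<beta> m dt = m\<^sub>1 - m\<^sub>0 \<ge> -1\<close> controls the negative part of \<open>\<beta>\<close>; this justifies Fubini's theorem.
\<close>

section \<open>Measures on a compact set and lifts to the cone\<close>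

text \<open>The traces on \<Omega> of closed sets form a generator stable under intersection. On
  \<Omega> the indicator of such a trace is the pointwise limit of the bounded continuous functions
  \<open>f n\<close>, so dominated convergence gives both measures the same values on the generator.
  The distance to a closed set is defined everywhere, so functions continuous on the whole space
  suffice as tests.\<close>

lemma fin_radon_eqI:
  fixes M N :: "'a::euclidean_space measure"
  assumes \<Omega>: "\<Omega> \<in> sets borel" and M: "M \<in> fin_radon \<Omega>" and N: "N \<in> fin_radon \<Omega>"
    and eq: "\<And>\<phi> :: 'a \<Rightarrow> real. continuous_on UNIV \<phi> \<Longrightarrow> bounded (range \<phi>) \<Longrightarrow> (\<integral>x. \<phi> x \<partial>M) = (\<integral>x. \<phi> x \<partial>N)"
  shows "M = N"
proof -
  have sets: "sets M = sets (borel_on \<Omega>)" "sets N = sets (borel_on \<Omega>)"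
    and fin: "finite_measure M" "finite_measure N"
    using M N by (auto simp: fin_radon_def)
  interpret M: finite_measure M by fact
  interpret N: finite_measure N by fact
  have space: "space M = \<Omega>" "space N = \<Omega>"
    using sets sets_eq_imp_space_eq[of M "borel_on \<Omega>"] sets_eq_imp_space_eq[of N "borel_on \<Omega>"]
    by (auto simp: space_restrict_space)
  let ?E = "(\<lambda>C. \<Omega> \<inter> C) ` {C. closed C}"
  have gen: "sets (borel_on \<Omega>) = sigma_sets \<Omega> ?E"
    using \<Omega> by (simp add: sets_restrict_space borel_eq_closed sigma_sets_Int)
  \<comment> \<open>The empty set is treated apart: \<open>infdist x {}\<close> is 0 by convention,
    which would make every \<open>f n\<close> constantly 1.\<close>
  have closed: "emeasure M (\<Omega> \<inter> C) = emeasure N (\<Omega> \<inter> C)" if C: "closed C" for C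
  proof (cases "C = {}")
    case False
    define f where "f n x = max 0 (1 - real n * infdist x C)" for n :: nat and x
    have fc: "continuous_on UNIV (f n)" for n
      unfolding f_def by (intro continuous_intros)
    have fb: "\<bar>f n x\<bar> \<le> 1" for n x
      by (auto simp: f_def infdist_nonneg)
    have [measurable]: "f n \<in> borel_measurable M" "f n \<in> borel_measurable N" for n
      using sets borel_measurable_continuous_onI[OF fc]
      by (simp_all add: measurable_restrict_space1 cong: measurable_cong_sets)
    have [measurable]: "\<Omega> \<inter> C \<in> sets M" "\<Omega> \<inter> C \<in> sets N"
      using C by (auto simp: sets sets_restrict_space)
    have lim: "(\<lambda>n. f n x) \<longlonglongrightarrow> indicator (\<Omega> \<inter> C) x" if "x \<in> \<Omega>" for x
    proof (cases "x \<in> C")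
      case True
      then show ?thesis using that by (simp add: f_def)
    next
      case x: False
      then have pos: "infdist x C > 0"
        using C False by (metis in_closed_iff_infdist_zero infdist_nonneg less_eq_real_def)
      obtain m where m: "real m * infdist x C > 1" using reals_Archimedean3[OF pos] by blast
      have "eventually (\<lambda>n. f n x = 0) sequentially"
        using eventually_ge_at_top[of m]
      proof eventually_elim
        case (elim n)
        then have "real m * infdist x C \<le> real n * infdist x C"
          by (intro mult_right_mono) (auto simp: infdist_nonneg)
        then show ?case using m by (simp add: f_def)
      qed
      then show ?thesis using x by (simp add: tendsto_eventually)
    qed
    have "(\<lambda>n. \<integral>x. f n x \<partial>M) \<longlonglongrightarrow> (\<integral>x. indicator (\<Omega> \<inter> C) x \<partial>M)"
      by (intro integral_dominated_convergence[where w="\<lambda>_. 1"]) (use fb lim space in auto)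
    moreover have "(\<lambda>n. \<integral>x. f n x \<partial>N) \<longlonglongrightarrow> (\<integral>x. indicator (\<Omega> \<inter> C) x \<partial>N)"
      by (intro integral_dominated_convergence[where w="\<lambda>_. 1"]) (use fb lim space in auto)
    moreover have "(\<integral>x. f n x \<partial>M) = (\<integral>x. f n x \<partial>N)" for n
      using fb by (intro eq fc) (auto simp: bounded_iff)
    ultimately have "(\<integral>x. indicator (\<Omega> \<inter> C) x \<partial>M) = (\<integral>x. indicator (\<Omega> \<inter> C) x \<partial>N :: real)"
      using LIMSEQ_unique by auto
    then have "measure M (\<Omega> \<inter> C) = measure N (\<Omega> \<inter> C)" by (simp add: space Int_absorb2)
    then show ?thesis by (simp add: M.emeasure_eq_measure N.emeasure_eq_measure)
  qed simp
  show ?thesis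
  proof (rule measure_eqI_generator_eq[where E="?E" and \<Omega>=\<Omega> and A="\<lambda>_. \<Omega>"])
    show "Int_stable ?E"
    proof (rule Int_stableI)
      fix a b assume "a \<in> ?E" "b \<in> ?E"
      then obtain C D where "closed C" "closed D" "a = \<Omega> \<inter> C" "b = \<Omega> \<inter> D" by auto
      then show "a \<inter> b \<in> ?E" by (intro image_eqI[of _ _ "C \<inter> D"]) (auto intro: closed_Int)
    qed
    show "range (\<lambda>_. \<Omega>) \<subseteq> ?E" by (auto intro!: image_eqI[of _ _ UNIV])
  qed (use closed sets gen in auto)
qed

section \<open>Measurability on the cone and lifts concentrated on graphs\<close>

lemma space_cone_borel: "space (cone_borel \<Omega>) = cone \<Omega>"
  unfolding cone_borel_def by (rule space_measure_of) (auto simp: openin_cone_topology)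

text \<open>Since \<open>cone_pt\<close> is a quotient map, continuity on the cone can be tested
  upstairs on \<Omega> \<times> [0,\<infinity>). The open sets of the quotient topology generate
  \<open>cone_borel\<close>.\<close>

lemma cone_borel_continuous_measurable:
  fixes f :: "('a::topological_space \<times> real) set \<Rightarrow> 'b::topological_space"
  assumes "continuous_on (\<Omega> \<times> {0..}) (\<lambda>p. f (cone_pt \<Omega> p))"
  shows "f \<in> borel_measurable (cone_borel \<Omega>)"
proof (rule borel_measurableI)
  fix S :: "'b set" assume "open S"
  have "continuous_map (cone_topology \<Omega>) euclidean f"
    using assms by (subst continuous_compose_quotient_map_eq[OF quotient_map_cone_pt, symmetric])
      (simp add: o_def)
  then have "openin (cone_topology \<Omega>) {c \<in> topspace (cone_topology \<Omega>). f c \<in> S}"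
    using \<open>open S\<close> by (auto simp: continuous_map_def)
  moreover have "{c \<in> topspace (cone_topology \<Omega>). f c \<in> S} = f -` S \<inter> space (cone_borel \<Omega>)"
    by (auto simp: topspace_cone_topology space_cone_borel)
  ultimately show "f -` S \<inter> space (cone_borel \<Omega>) \<in> sets (cone_borel \<Omega>)"
    unfolding cone_borel_def by (subst sets_measure_of) (auto simp: openin_cone_topology)
qed

lemma cone_radius_measurable: "cone_radius \<in> borel_measurable (cone_borel \<Omega>)"
  by (rule cone_borel_continuous_measurable)
    (auto simp: cone_coordinates intro!: continuous_on_eq[OF continuous_on_snd[OF continuous_on_id]])

text \<open>At the apex the base coordinate is arbitrary, but the factor
  \<open>\<rho>\<^sup>2\<close> vanishes there. Hence the weighted function on the cone lifts to a
  continuous function upstairs whenever \<phi> is continuous.\<close>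

lemma cone_weight_pt:
  assumes "x \<in> \<Omega>" "\<rho> \<ge> 0"
  shows "(cone_radius (cone_pt \<Omega> (x, \<rho>)))\<^sup>2 * \<phi> (cone_base (cone_pt \<Omega> (x, \<rho>))) = \<rho>\<^sup>2 * (\<phi> x :: real)"
  using cone_coordinates[of "(x, \<rho>)" \<Omega>] assms by (cases "\<rho> = 0") auto

lemma cone_weight_measurable:
  fixes \<phi> :: "'a::topological_space \<Rightarrow> real"
  assumes "continuous_on \<Omega> \<phi>"
  shows "(\<lambda>c. (cone_radius c)\<^sup>2 * \<phi> (cone_base c)) \<in> borel_measurable (cone_borel \<Omega>)"
proof (rule cone_borel_continuous_measurable)
  have "continuous_on (\<Omega> \<times> {0..}) (\<lambda>p. (snd p)\<^sup>2 * \<phi> (fst p))"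
    by (intro continuous_intros continuous_on_compose2[OF assms]) auto
  then show "continuous_on (\<Omega> \<times> {0..}) (\<lambda>p. (cone_radius (cone_pt \<Omega> p))\<^sup>2 * \<phi> (cone_base (cone_pt \<Omega> p)))"
    by (rule continuous_on_eq) (auto simp: cone_weight_pt)
qed

lemma cone_pt_measurable:
  fixes \<rho> :: "'a::euclidean_space \<Rightarrow> real"
  assumes \<rho>: "\<rho> \<in> borel_measurable (borel_on \<Omega>)" "\<And>x. x \<in> \<Omega> \<Longrightarrow> \<rho> x \<ge> 0"
  shows "(\<lambda>x. cone_pt \<Omega> (x, \<rho> x)) \<in> measurable (borel_on \<Omega>) (cone_borel \<Omega>)"
  unfolding cone_borel_def
proof (rule measurable_measure_of)
  show "{U. openin (cone_topology \<Omega>) U} \<subseteq> Pow (cone \<Omega>)"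
    by (auto simp: openin_cone_topology)
  show "(\<lambda>x. cone_pt \<Omega> (x, \<rho> x)) \<in> space (borel_on \<Omega>) \<rightarrow> cone \<Omega>"
    using \<rho>(2) by (auto simp: space_restrict_space intro!: cone_pt_in_cone)
  fix U assume "U \<in> {U. openin (cone_topology \<Omega>) U}"
  then obtain T where T: "open T" "{p \<in> \<Omega> \<times> {0..}. cone_pt \<Omega> p \<in> U} = (\<Omega> \<times> {0..}) \<inter> T"
    by (auto simp: openin_cone_topology openin_open)
  have "(\<lambda>x. x) \<in> borel_measurable (borel_on \<Omega>)"
    by (rule measurable_restrict_space1) simp
  then have "(\<lambda>x. (x, \<rho> x)) \<in> borel_measurable (borel_on \<Omega>)"
    using \<rho>(1) by (rule borel_measurable_Pair)
  then have "(\<lambda>x. (x, \<rho> x)) -` T \<inter> space (borel_on \<Omega>) \<in> sets (borel_on \<Omega>)"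
    using T(1) by (auto intro: measurable_sets)
  moreover have "(\<lambda>x. (x, \<rho> x)) -` T \<inter> space (borel_on \<Omega>) = (\<lambda>x. cone_pt \<Omega> (x, \<rho> x)) -` U \<inter> space (borel_on \<Omega>)"
    using T(2) \<rho>(2) by (fastforce simp: space_restrict_space set_eq_iff)
  ultimately show "(\<lambda>x. cone_pt \<Omega> (x, \<rho> x)) -` U \<inter> space (borel_on \<Omega>) \<in> sets (borel_on \<Omega>)"
    by simp
qed

text \<open>On the graph the radius is \<rho> and the base point is x, so both the density and the
  weighted integral over the cone test \<phi> against \<open>\<rho>\<^sup>2\<close> times
  \<open>N\<close>.\<close>

lemma is_lift_graph:
  fixes N :: "'a::euclidean_space measure"
  assumes \<Omega>: "\<Omega> \<in> sets borel" and N: "sets N = sets (borel_on \<Omega>)" "finite_measure N"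
    and \<rho>: "\<rho> \<in> borel_measurable (borel_on \<Omega>)" "\<And>x. x \<in> \<Omega> \<Longrightarrow> \<rho> x \<ge> 0"
    and fin: "(\<integral>\<^sup>+x. ennreal ((\<rho> x)\<^sup>2) \<partial>N) < \<infinity>"
  shows "is_lift \<Omega> (distr N (cone_borel \<Omega>) (\<lambda>x. cone_pt \<Omega> (x, \<rho> x))) (density N (\<lambda>x. ennreal ((\<rho> x)\<^sup>2)))"
    (is "is_lift \<Omega> ?lam ?\<mu>")
proof -
  interpret N: finite_measure N by fact
  have space: "space N = \<Omega>"
    using sets_eq_imp_space_eq[OF N(1)] by (simp add: space_restrict_space)
  have [measurable]: "\<rho> \<in> borel_measurable N"
    using \<rho>(1) N(1) by (simp cong: measurable_cong_sets)
  have pt[measurable]: "(\<lambda>x. cone_pt \<Omega> (x, \<rho> x)) \<in> measurable N (cone_borel \<Omega>)"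
    using cone_pt_measurable[OF \<rho>] N(1) by (simp cong: measurable_cong_sets)
  have rad: "cone_radius (cone_pt \<Omega> (x, \<rho> x)) = \<rho> x" if "x \<in> \<Omega>" for x
    using that \<rho>(2) by (simp add: cone_coordinates)
  have "(\<integral>\<^sup>+c. ennreal ((cone_radius c)\<^sup>2) \<partial>?lam) = (\<integral>\<^sup>+x. ennreal ((\<rho> x)\<^sup>2) \<partial>N)"
    using cone_radius_measurable[of \<Omega>]
    by (subst nn_integral_distr) (auto intro!: nn_integral_cong simp: rad space)
  then have lam: "?lam \<in> cone_measures \<Omega>"
    using fin by (auto simp: cone_measures_def intro!: N.finite_measure_distr)
  have \<mu>: "?\<mu> \<in> fin_radon \<Omega>"
    unfolding fin_radon_def using fin N(1)
    by (auto intro!: finite_measureI simp: emeasure_density cong: nn_integral_cong)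
  have eq: "(\<integral>x. \<phi> x \<partial>?\<mu>) = (\<integral>c. (cone_radius c)\<^sup>2 * \<phi> (cone_base c) \<partial>?lam)"
    if c: "continuous_on \<Omega> \<phi>" for \<phi> :: "'a \<Rightarrow> real"
  proof -
    have "\<phi> \<in> borel_measurable N"
      using borel_measurable_continuous_on_restrict[OF c] N(1) by (simp cong: measurable_cong_sets)
    then show ?thesis
      using cone_weight_measurable[OF c] \<rho>(2)
      by (subst integral_distr integral_density)
        (auto intro!: Bochner_Integration.integral_cong simp: integral_density integral_distr space cone_weight_pt)
  qed
  \<comment> \<open>\<open>cone_proj\<close> is a definite description, so besides having the
    defining property the density must be shown to be the only such measure; this is where
    \<open>fin_radon_eqI\<close> enters.\<close>
  have "cone_proj \<Omega> ?lam = ?\<mu>"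
    unfolding cone_proj_def
  proof (rule the_equality)
    fix \<nu> assume "\<nu> \<in> fin_radon \<Omega> \<and> (\<forall>\<phi>. continuous_on \<Omega> \<phi> \<longrightarrow>
        (\<integral>x. \<phi> x \<partial>\<nu>) = (\<integral>c. (cone_radius c)\<^sup>2 * \<phi> (cone_base c) \<partial>?lam))"
    then have \<nu>: "\<nu> \<in> fin_radon \<Omega>" and "\<And>\<phi> :: 'a \<Rightarrow> real. continuous_on \<Omega> \<phi> \<Longrightarrow> (\<integral>x. \<phi> x \<partial>\<nu>) = (\<integral>x. \<phi> x \<partial>?\<mu>)"
      using eq by auto
    then show "\<nu> = ?\<mu>"
      by (intro fin_radon_eqI[OF \<Omega> _ \<mu>]) (auto intro: continuous_on_subset)
  qed (use \<mu> eq in blast)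
  then show ?thesis using lam by (simp add: is_lift_def)
qed

section \<open>Products with exponentials of primitives\<close>

text \<open>For integrable \<open>b\<close> this is the solution of \<open>m' = c * b * m\<close>
  with initial value 1, in the absolutely continuous sense. It is total in \<open>t\<close>: for
  negative \<open>t\<close> the interval is empty and the value is 1.\<close>

definition expint :: "real \<Rightarrow> (real \<Rightarrow> real) \<Rightarrow> real \<Rightarrow> real" where
  "expint c b t = exp (c * (\<integral>s. indicator {0..t} s * b s \<partial>lborel))"

lemma expint_measurable:
  assumes b[measurable]: "b \<in> borel_measurable lborel"
  shows "expint c b \<in> borel_measurable borel"
proof -
  \<comment> \<open>Rewriting the indicator as a condition on both coordinates exhibits it as
    jointly measurable, so the integral depends measurably on its upper limit.\<close>
  have "(\<lambda>p. indicator {0..fst p} (snd p) * b (snd p)) =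
     (\<lambda>p. (if 0 \<le> snd p \<and> snd p \<le> fst p then 1 else 0) * b (snd p :: real))"
    by (auto simp: indicator_def)
  then have "(\<lambda>p. indicator {0..fst p} (snd p) * b (snd p)) \<in> borel_measurable (borel \<Otimes>\<^sub>M lborel)"
    by simp
  then have "(\<lambda>t. \<integral>s. indicator {0..t} s * b s \<partial>lborel) \<in> borel_measurable borel"
    by (intro lborel.borel_measurable_lebesgue_integral) (simp add: case_prod_unfold)
  then show ?thesis unfolding expint_def[abs_def] by measurable
qed

lemma abs_primitive_le:
  fixes b w :: "real \<Rightarrow> real"
  assumes "b \<in> borel_measurable lborel" "integrable lborel w" "AE s in lborel. \<bar>b s\<bar> \<le> w s"
  shows "\<bar>\<integral>s. indicator {0..t} s * b s \<partial>lborel\<bar> \<le> (\<integral>s. w s \<partial>lborel)"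
proof -
  have ab: "AE s in lborel. \<bar>indicator {0..t} s * b s\<bar> \<le> w s"
    using assms(3) by eventually_elim (auto simp: indicator_def)
  have [measurable]: "b \<in> borel_measurable lborel" by fact
  have int: "integrable lborel (\<lambda>s. indicator {0..t} s * b s)"
    by (rule Bochner_Integration.integrable_bound[OF assms(2)])
       (use ab in \<open>auto elim!: eventually_mono\<close>)
  have "\<bar>\<integral>s. indicator {0..t} s * b s \<partial>lborel\<bar> \<le> (\<integral>s. \<bar>indicator {0..t} s * b s\<bar> \<partial>lborel)"
    by (rule integral_abs_bound)
  also have "\<dots> \<le> (\<integral>s. w s \<partial>lborel)"
    by (rule integral_mono_AE) (use int assms(2) ab in auto)
  finally show ?thesis .
qed

lemma expint_le:
  fixes b w :: "real \<Rightarrow> real"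
  assumes "b \<in> borel_measurable lborel" "integrable lborel w" "AE s in lborel. \<bar>b s\<bar> \<le> w s"
  shows "expint c b t \<le> exp (\<bar>c\<bar> * (\<integral>s. w s \<partial>lborel))"
proof -
  have "c * (\<integral>s. indicator {0..t} s * b s \<partial>lborel) \<le> \<bar>c\<bar> * \<bar>\<integral>s. indicator {0..t} s * b s \<partial>lborel\<bar>"
    by (metis abs_ge_self abs_mult)
  also have "\<dots> \<le> \<bar>c\<bar> * (\<integral>s. w s \<partial>lborel)"
    by (intro mult_left_mono abs_primitive_le assms) auto
  finally show ?thesis unfolding expint_def by simp
qed

text \<open>With \<open>u'\<close> the derivative of \<open>u\<close>, this is the derivative of \<open>t \<mapsto> u t * expint c b t\<close>, cut off outside \<open>[0,1]\<close>.\<close>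

definition expint_deriv :: "(real \<Rightarrow> real) \<Rightarrow> (real \<Rightarrow> real) \<Rightarrow> real \<Rightarrow> (real \<Rightarrow> real) \<Rightarrow> real \<Rightarrow> real" where
  "expint_deriv u u' c b t = indicator {0..1} t * ((u' t + c * u t * b t) * expint c b t)"

text \<open>In the application \<open>u\<close> is a test function along a trajectory, or the
  constant 1. The derivative is assumed measurable only after a cut-off because trajectories are
  considered on the time interval [0,1] alone.\<close>

context
  fixes u u' :: "real \<Rightarrow> real" and c C :: real
  assumes u_deriv: "\<And>t. t \<in> {0..1} \<Longrightarrow> (u has_vector_derivative u' t) (at t within {0..1})"
    and u'_meas: "(\<lambda>t. indicator {0..1} t * u' t) \<in> borel_measurable borel"
    and u'_bound: "\<And>t. t \<in> {0..1} \<Longrightarrow> \<bar>u' t\<bar> \<le> C"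
begin

abbreviation prod_deriv :: "(real \<Rightarrow> real) \<Rightarrow> real \<Rightarrow> real" where
  "prod_deriv \<equiv> expint_deriv u u' c"

private lemma u_cont: "continuous_on {0..1} u"
  by (rule continuous_on_vector_derivative[of _ _ u']) (rule u_deriv)

private lemma u_meas: "(\<lambda>t. indicator {0..1} t * u t) \<in> borel_measurable borel"
  using borel_measurable_continuous_on_indicator[OF _ u_cont] by simp

private lemma u_bounded: "\<exists>K\<ge>0. \<forall>t\<in>{0..1}. \<bar>u t\<bar> \<le> K"
proof -
  have "bounded (u ` {0..1})"
    by (intro compact_imp_bounded compact_continuous_image u_cont) auto
  then obtain K where "\<forall>t\<in>{0..1}. \<bar>u t\<bar> \<le> K" unfolding bounded_iff by auto
  then show ?thesis by (intro exI[of _ "max K 0"]) force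
qed

lemma expint_deriv_measurable:
  assumes [measurable]: "b \<in> borel_measurable lborel"
  shows "prod_deriv b \<in> borel_measurable lborel"
proof -
  note [measurable] = u_meas u'_meas expint_measurable[OF assms]
  have "prod_deriv b = (\<lambda>t. (indicator {0..1} t * u' t + c * (indicator {0..1} t * u t) * b t) * expint c b t)"
    by (auto simp: expint_deriv_def fun_eq_iff indicator_def)
  then show ?thesis by simp
qed

text \<open>A single \<open>W\<close> serves all \<open>b\<close> dominated by \<open>w\<close>, as
  dominated convergence along a sequence of such \<open>b\<close> requires. It comes from bounding
  \<open>u'\<close> by \<open>C\<close>, \<open>u\<close> by its maximum on [0,1], and the
  exponential through the integral of \<open>w\<close>.\<close>

lemma expint_deriv_dominated:
  fixes w :: "real \<Rightarrow> real"
  assumes w: "integrable lborel w"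
  obtains W where "integrable lborel W"
    "\<And>b. b \<in> borel_measurable lborel \<Longrightarrow> (AE s in lborel. \<bar>b s\<bar> \<le> w s) \<Longrightarrow>
       (AE t in lborel. \<bar>prod_deriv b t\<bar> \<le> W t)"
proof -
  obtain K where K: "K \<ge> 0" "\<And>t. t\<in>{0..1} \<Longrightarrow> \<bar>u t\<bar> \<le> K" using u_bounded by auto
  define W where "W t = (indicator {0..1} t * C + \<bar>c\<bar> * K * w t) * exp (\<bar>c\<bar> * (\<integral>s. w s \<partial>lborel))" for t
  show ?thesis
  proof
    have "integrable lborel (\<lambda>t. indicator {0..1::real} t * C)"
      by (rule integrable_mult_left, rule integrable_real_indicator) auto
    then have "integrable lborel (\<lambda>t. indicator {0..1} t * C + \<bar>c\<bar> * K * w t)"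
      using w by (rule Bochner_Integration.integrable_add[OF _ integrable_mult_right])
    then show "integrable lborel W"
      unfolding W_def[abs_def] by (rule integrable_mult_left)
  next
    fix b :: "real \<Rightarrow> real"
    assume b: "b \<in> borel_measurable lborel" "AE s in lborel. \<bar>b s\<bar> \<le> w s"
    from b(2) show "AE t in lborel. \<bar>prod_deriv b t\<bar> \<le> W t"
    proof eventually_elim
      fix t assume bt: "\<bar>b t\<bar> \<le> w t"
      show "\<bar>prod_deriv b t\<bar> \<le> W t"
      proof (cases "t \<in> {0..1}")
        case True
        have "\<bar>u' t + c * u t * b t\<bar> \<le> \<bar>u' t\<bar> + \<bar>c\<bar> * \<bar>u t\<bar> * \<bar>b t\<bar>"
          by (metis abs_mult abs_triangle_ineq)
        also have "\<dots> \<le> C + \<bar>c\<bar> * K * w t"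
          using u'_bound[OF True] K(2)[OF True] K(1) bt by (intro add_mono mult_mono) auto
        finally have 1: "\<bar>u' t + c * u t * b t\<bar> \<le> C + \<bar>c\<bar> * K * w t" .
        have "\<bar>prod_deriv b t\<bar> = \<bar>u' t + c * u t * b t\<bar> * expint c b t"
          using True by (simp add: expint_deriv_def abs_mult expint_def)
        also have "\<dots> \<le> (C + \<bar>c\<bar> * K * w t) * exp (\<bar>c\<bar> * (\<integral>s. w s \<partial>lborel))"
          using 1 expint_le[OF b(1) w b(2)] by (intro mult_mono) (auto simp: expint_def)
        finally show ?thesis using True by (simp add: W_def)
      next
        case False
        have "0 \<le> w t" using bt by linarith
        then show ?thesis using False K(1) by (simp add: expint_deriv_def W_def)
      qed
    qed
  qed
qed

lemma expint_deriv_integrable: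
  assumes "integrable lborel b"
  shows "integrable lborel (prod_deriv b)"
proof -
  obtain W where W: "integrable lborel W"
    "\<And>b'. b' \<in> borel_measurable lborel \<Longrightarrow> (AE s in lborel. \<bar>b' s\<bar> \<le> \<bar>b s\<bar>) \<Longrightarrow>
       (AE t in lborel. \<bar>prod_deriv b' t\<bar> \<le> W t)"
    using expint_deriv_dominated[of "\<lambda>s. \<bar>b s\<bar>"] assms by auto
  have bm: "b \<in> borel_measurable lborel" using assms by auto
  show ?thesis
    using W(2)[OF bm] by (intro Bochner_Integration.integrable_bound[OF W(1)] expint_deriv_measurable bm)
      (auto elim!: eventually_mono)
qed

text \<open>The fundamental theorem for \<^term>\<open>expint_deriv u u' c b\<close> is stable under dominated convergence of \<open>b\<close>.
  Since measurable functions are limits almost everywhere of continuous ones, it passes from continuous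
  to bounded and then, by truncation, to integrable \<open>b\<close>.\<close>

lemma integral_expint_deriv_limit:
  assumes w: "integrable lborel w"
    and meas: "\<And>n. b n \<in> borel_measurable lborel" "b' \<in> borel_measurable lborel"
    and bound: "\<And>n. AE s in lborel. \<bar>b n s\<bar> \<le> w s"
    and lim: "AE s in lborel. (\<lambda>n. b n s) \<longlonglongrightarrow> b' s"
    and eq: "\<And>n. integral\<^sup>L lborel (prod_deriv (b n)) = u 1 * expint c (b n) 1 - u 0"
  shows "integral\<^sup>L lborel (prod_deriv b') = u 1 * expint c b' 1 - u 0"
proof -
  note [measurable] = meas
  obtain W where W: "integrable lborel W"
    "\<And>b'. b' \<in> borel_measurable lborel \<Longrightarrow> (AE s in lborel. \<bar>b' s\<bar> \<le> w s) \<Longrightarrow>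
       (AE t in lborel. \<bar>prod_deriv b' t\<bar> \<le> W t)"
    using expint_deriv_dominated[OF w] by auto
  have E: "(\<lambda>n. expint c (b n) t) \<longlonglongrightarrow> expint c b' t" for t
    unfolding expint_def
  proof (intro tendsto_intros integral_dominated_convergence[where w=w])
    show "AE s in lborel. (\<lambda>n. indicator {0..t} s * b n s) \<longlonglongrightarrow> indicator {0..t} s * b' s"
      using lim by eventually_elim (intro tendsto_intros)
    show "AE s in lborel. norm (indicator {0..t} s * b n s) \<le> w s" for n
      using bound[of n] by eventually_elim (auto simp: indicator_def)
  qed (use w in auto)
  have "(\<lambda>n. integral\<^sup>L lborel (prod_deriv (b n))) \<longlonglongrightarrow> integral\<^sup>L lborel (prod_deriv b')"
  proof (intro integral_dominated_convergence[where w=W])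
    show "AE t in lborel. (\<lambda>n. prod_deriv (b n) t) \<longlonglongrightarrow> prod_deriv b' t"
      using lim unfolding expint_deriv_def by eventually_elim (intro tendsto_intros E)
    show "AE t in lborel. norm (prod_deriv (b n) t) \<le> W t" for n
      using W(2)[OF meas(1) bound] by simp
  qed (use W(1) expint_deriv_measurable meas in auto)
  moreover have "(\<lambda>n. integral\<^sup>L lborel (prod_deriv (b n))) \<longlonglongrightarrow> u 1 * expint c b' 1 - u 0"
    unfolding eq by (intro tendsto_intros E)
  ultimately show ?thesis by (rule LIMSEQ_unique)
qed

text \<open>For continuous \<open>g\<close> the primitive is differentiable at every point of [0,1],
  so the product rule and the classical fundamental theorem apply.\<close>

lemma integral_expint_deriv_continuous:
  assumes g: "continuous_on UNIV g"
  shows "integral\<^sup>L lborel (prod_deriv (\<lambda>t. indicator {0..1} t * g t))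
    = u 1 * expint c (\<lambda>t. indicator {0..1} t * g t) 1 - u 0"
proof -
  let ?b = "\<lambda>t. indicator {0..1} t * g t :: real"
  have gI: "continuous_on S g" for S using g continuous_on_subset by blast
  have prim: "(\<integral>s. indicator {0..t} s * ?b s \<partial>lborel) = integral {0..t} g" if "t \<in> {0..1}" for t
  proof -
    have "(\<integral>s. indicator {0..t} s * ?b s \<partial>lborel) = (LBINT s:{0..t}. g s)"
      unfolding set_lebesgue_integral_def
      by (intro Bochner_Integration.integral_cong) (use that in \<open>auto simp: indicator_def\<close>)
    also have "\<dots> = integral {0..t} g"
      by (intro set_borel_integral_eq_integral borel_integrable_atLeastAtMost' gI)
    finally show ?thesis .
  qed
  let ?E = "\<lambda>t. exp (c * integral {0..t} g)"
  have E: "expint c ?b t = ?E t" if "t \<in> {0..1}" for t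
    using prim[OF that] by (simp add: expint_def)
  have "((\<lambda>t. (u' t + c * u t * ?b t) * expint c ?b t) has_integral (u 1 * ?E 1 - u 0 * ?E 0)) {0..1}"
  proof (rule fundamental_theorem_of_calculus)
    fix t :: real assume t: "t \<in> {0..1}"
    have d: "((\<lambda>t. integral {0..t} g) has_vector_derivative g t) (at t within {0..1})"
      by (rule integral_has_vector_derivative[OF gI t])
    have "((\<lambda>t. u t * ?E t) has_vector_derivative u t * (?E t * (c * g t)) + u' t * ?E t) (at t within {0..1})"
      using u_deriv[OF t] d
      unfolding has_real_derivative_iff_has_vector_derivative[symmetric]
      by (auto intro!: derivative_eq_intros)
    then show "((\<lambda>t. u t * ?E t) has_vector_derivative (u' t + c * u t * ?b t) * expint c ?b t) (at t within {0..1})"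
      using t E[OF t] by (simp add: algebra_simps)
  qed auto
  then have 1: "integral {0..1} (\<lambda>t. (u' t + c * u t * ?b t) * expint c ?b t) = u 1 * ?E 1 - u 0"
    by (simp add: integral_unique)
  have "integrable lborel ?b"
    using borel_integrable_atLeastAtMost'[OF gI, of 0 1] by (simp add: set_integrable_def)
  \<comment> \<open>The fundamental theorem speaks of the gauge integral; absolute integrability is
    what allows its value to be read as a Lebesgue integral.\<close>
  then have "set_integrable lborel {0..1} (\<lambda>t. (u' t + c * u t * ?b t) * expint c ?b t)"
    using expint_deriv_integrable[of ?b] unfolding set_integrable_def expint_deriv_def by simp
  from set_borel_integral_eq_integral(2)[OF this] 1 E[of 1] show ?thesis
    unfolding set_lebesgue_integral_def expint_deriv_def[abs_def] by simp
qed

lemma integral_expint_deriv_bounded: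
  assumes b[measurable]: "b \<in> borel_measurable lborel"
    and bK: "\<And>t. \<bar>b t\<bar> \<le> K * indicator {0..1} t"
  shows "integral\<^sup>L lborel (prod_deriv b) = u 1 * expint c b 1 - u 0"
proof -
  \<comment> \<open>This supplies continuous functions \<open>g n\<close> converging to
    \<open>b\<close> off a negligible set.\<close>
  have "b measurable_on UNIV"
    by (intro lebesgue_measurable_imp_measurable_on measurable_completion b) simp
  then obtain N g where N: "negligible N" and g: "\<And>n. continuous_on UNIV (g n)"
    and lim: "\<And>x. x \<notin> N \<Longrightarrow> (\<lambda>n::nat. g n x) \<longlonglongrightarrow> b x"
    unfolding measurable_on_def by auto
  \<comment> \<open>Truncation at height \<open>K\<close> makes the approximations uniformly bounded
    and keeps them continuous; the limit is unchanged because \<open>b\<close> itself stays within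
    these bounds.\<close>
  define h where "h n t = max (-K) (min K (g n t))" for n t
  have K0: "K \<ge> 0" using bK[of 0] by simp
  have hc: "continuous_on UNIV (h n)" for n unfolding h_def by (intro continuous_intros g)
  have [measurable]: "h n \<in> borel_measurable borel" for n
    by (rule borel_measurable_continuous_onI[OF hc])
  have AEN: "AE x in lborel. x \<notin> N"
    using N by (metis AE_completion_iff negligible_iff_null_sets AE_not_in)
  show ?thesis
  proof (rule integral_expint_deriv_limit[where w="\<lambda>t. K * indicator {0..1} t" and b="\<lambda>n t. indicator {0..1} t * h n t"])
    show "integrable lborel (\<lambda>t. K * indicator {0..1::real} t)"
      by (intro integrable_mult_right integrable_real_indicator) auto
    show "AE s in lborel. \<bar>indicator {0..1} s * h n s\<bar> \<le> K * indicator {0..1} s" for n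
      using K0 by (auto simp: h_def indicator_def)
    show "AE s in lborel. (\<lambda>n. indicator {0..1} s * h n s) \<longlonglongrightarrow> b s"
      using AEN
    proof eventually_elim
      fix s assume "s \<notin> N"
      then have "(\<lambda>n. indicator {0..1} s * h n s) \<longlonglongrightarrow> indicator {0..1} s * max (-K) (min K (b s))"
        unfolding h_def by (intro tendsto_intros lim)
      moreover have "indicator {0..1} s * max (-K) (min K (b s)) = b s"
        using bK[of s] by (auto simp: indicator_def split: if_splits)
      ultimately show "(\<lambda>n. indicator {0..1} s * h n s) \<longlonglongrightarrow> b s" by simp
    qed
  qed (use integral_expint_deriv_continuous[OF hc] in auto)
qed

lemma integral_expint_deriv:
  assumes b: "integrable lborel b"
  shows "integral\<^sup>L lborel (prod_deriv b) = u 1 * expint c b 1 - u 0"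
proof -
  have [measurable]: "b \<in> borel_measurable lborel" using b by auto
  let ?b = "\<lambda>t. indicator {0..1} t * b t"
  have "integral\<^sup>L lborel (prod_deriv ?b) = u 1 * expint c ?b 1 - u 0"
  proof (rule integral_expint_deriv_limit[where w="\<lambda>t. \<bar>b t\<bar>"
       and b="\<lambda>n t. indicator {0..1} t * max (- real n) (min (real n) (b t))"])
    show "AE s in lborel. (\<lambda>n. indicator {0..1} s * max (- real n) (min (real n) (b s))) \<longlonglongrightarrow> ?b s"
    proof (rule AE_I2)
      fix s
      obtain m where m: "\<bar>b s\<bar> \<le> real m" using real_arch_simple by blast
      have "eventually (\<lambda>n. indicator {0..1} s * max (- real n) (min (real n) (b s)) = ?b s) sequentially"
        using eventually_ge_at_top[of m]
      proof eventually_elim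
        case (elim n)
        then have "\<bar>b s\<bar> \<le> real n" using m by linarith
        then show ?case by (auto simp: indicator_def)
      qed
      then show "(\<lambda>n. indicator {0..1} s * max (- real n) (min (real n) (b s))) \<longlonglongrightarrow> ?b s"
        by (rule tendsto_eventually)
    qed
    show "AE s in lborel. \<bar>indicator {0..1} s * max (- real n) (min (real n) (b s))\<bar> \<le> \<bar>b s\<bar>" for n
      by (auto simp: indicator_def)
    show "integral\<^sup>L lborel (prod_deriv (\<lambda>t. indicator {0..1} t * max (- real n) (min (real n) (b t)))) =
      u 1 * expint c (\<lambda>t. indicator {0..1} t * max (- real n) (min (real n) (b t))) 1 - u 0" for n
      by (rule integral_expint_deriv_bounded[where K="real n"]) (auto simp: indicator_def)
  qed (use b in auto)
  \<comment> \<open>The cut-off to [0,1] gave the truncations the bound demanded by the bounded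
    case. Neither side of the identity sees \<open>b\<close> outside [0,1], so it can now be
    removed.\<close>
  moreover have E: "expint c ?b t = expint c b t" if "t \<in> {0..1}" for t
  proof -
    have "(\<lambda>s. indicator {0..t} s * (indicator {0..1} s * b s)) = (\<lambda>s. indicator {0..t} s * b s)"
      using that by (auto split: split_indicator)
    then show ?thesis by (simp add: expint_def)
  qed
  moreover have "prod_deriv ?b = prod_deriv b"
    using E by (auto simp: expint_deriv_def fun_eq_iff indicator_def)
  ultimately show ?thesis by simp
qed

end

section \<open>Transport along a flow\<close>

text \<open>Turns the pointwise operators \<open>deriv\<close> and \<open>grad\<close> of the
  integrand into continuous functions, and keeps the total derivative for the chain rule along
  trajectories.\<close>

lemma C1_partials:
  fixes \<phi> :: "real \<times> 'a::euclidean_space \<Rightarrow> real"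
  assumes "C1 \<phi>"
  obtains p q where "continuous_on UNIV p" "continuous_on UNIV q"
    "\<And>t x. deriv (\<lambda>s. \<phi> (s, x)) t = p (t, x)"
    "\<And>t x. grad (\<lambda>y. \<phi> (t, y)) x = q (t, x)"
    "\<And>t x. (\<phi> has_derivative (\<lambda>(s, h). s * p (t, x) + inner (q (t, x)) h)) (at (t, x))"
proof -
  obtain D where D: "\<And>z. (\<phi> has_derivative blinfun_apply (D z)) (at z)" and cD: "continuous_on UNIV D"
    using assms unfolding C1_def by auto
  define p where "p z = blinfun_apply (D z) (1, 0)" for z
  \<comment> \<open>The Riesz representative of the spatial part of \<open>D z\<close>, expanded in
    the orthonormal basis so that its continuity follows from that of \<open>D\<close>.\<close>
  define q where "q z = (\<Sum>i\<in>Basis. blinfun_apply (D z) (0, i) *\<^sub>R i)" for z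
  have snd: "blinfun_apply (D z) (0, h) = inner (q z) h" for z h
  proof -
    have "linear (\<lambda>h. blinfun_apply (D z) (0, h))"
      by (intro linearI)
        (simp add: blinfun.add_right[symmetric],
          metis blinfun.scaleR_right scaleR_Pair scale_zero_right)
    then have "blinfun_apply (D z) (0, h) = (\<Sum>i\<in>Basis. inner h i * blinfun_apply (D z) (0, i))"
      using linear_sum[of "\<lambda>h. blinfun_apply (D z) (0, h)" "\<lambda>i. inner h i *\<^sub>R i" Basis]
      by (simp add: euclidean_representation linear_cmul[OF \<open>linear _\<close>] del: scaleR_Pair)
    also have "\<dots> = inner (q z) h"
      unfolding q_def inner_sum_left inner_scaleR_left
      by (intro sum.cong refl) (simp add: inner_commute mult.commute)
    finally show ?thesis .
  qed
  have split: "blinfun_apply (D z) (s, h) = s * p z + inner (q z) h" for z s h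
  proof -
    have "(s, h) = s *\<^sub>R (1, 0) + (0, h)" by simp
    then have "blinfun_apply (D z) (s, h) = s *\<^sub>R blinfun_apply (D z) (1, 0) + blinfun_apply (D z) (0, h)"
      by (simp only: blinfun.add_right blinfun.scaleR_right)
    then show ?thesis by (simp add: snd p_def)
  qed
  show ?thesis
  proof (rule that)
    show "continuous_on UNIV p" "continuous_on UNIV q"
      unfolding p_def q_def by (intro continuous_intros cD)+
    show "(\<phi> has_derivative (\<lambda>(s, h). s * p (t, x) + inner (q (t, x)) h)) (at (t, x))" for t x
      using D[of "(t, x)"] by (rule has_derivative_eq_rhs) (auto simp: split)
    show "deriv (\<lambda>s. \<phi> (s, x)) t = p (t, x)" for t x
    proof -
      have "((\<lambda>s. \<phi> (s, x)) has_derivative (\<lambda>h. blinfun_apply (D (t, x)) (h, 0))) (at t)"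
        by (rule has_derivative_compose[OF _ D, of "\<lambda>s. (s, x)" "\<lambda>h. (h, 0)"])
          (auto intro!: derivative_eq_intros)
      then show ?thesis
        by (intro DERIV_imp_deriv) (simp add: has_field_derivative_def split mult.commute[of _ "p _"])
    qed
    show "grad (\<lambda>y. \<phi> (t, y)) x = q (t, x)" for t x
    proof -
      have "((\<lambda>y. \<phi> (t, y)) has_derivative (\<lambda>h. blinfun_apply (D (t, x)) (0, h))) (at x)"
        by (rule has_derivative_compose[OF _ D, of "\<lambda>y. (t, y)" "\<lambda>h. (0, h)"])
          (auto intro!: derivative_eq_intros)
      then show ?thesis
        by (intro grad_eqI) (simp add: gderiv_def split inner_commute)
    qed
  qed
qed

lemma C1_continuous: "C1 \<phi> \<Longrightarrow> continuous_on UNIV \<phi>"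
  unfolding C1_def by (auto intro: has_derivative_continuous_on has_derivative_at_withinI)

text \<open>\<open>M\<close> is the initial datum. The field \<beta> is bounded from above only, so
  its negative part has to be controlled through the evolution of mass.\<close>

locale bounded_reaction_flow = M: finite_measure M
  for M :: "'a::euclidean_space measure" +
  fixes \<Omega> :: "'a set" and v X :: "real \<Rightarrow> 'a \<Rightarrow> 'a" and \<beta> :: "real \<Rightarrow> 'a \<Rightarrow> real" and V K :: real
  assumes compact: "compact \<Omega>"
    and sets_M: "sets M = sets (borel_on \<Omega>)"
    and fields: "borel_fields \<Omega> v \<beta>"
    and V: "\<And>t x. t \<in> {0..1} \<Longrightarrow> x \<in> \<Omega> \<Longrightarrow> norm (v t x) \<le> V"
    and flow: "is_flow \<Omega> v X"
    and L1: "AE x in M. set_integrable lborel {0<..<1} (\<lambda>s. \<beta> s (X s x))"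
    and K: "\<And>t x. t \<in> {0..1} \<Longrightarrow> x \<in> \<Omega> \<Longrightarrow> \<beta> t x \<le> K" "K \<ge> 0"
begin

interpretation P: pair_sigma_finite M lborel by unfold_locales

section \<open>Measurability along trajectories\<close>

lemma space_M: "space M = \<Omega>"
  using sets_eq_imp_space_eq[OF sets_M] by (simp add: space_restrict_space)

lemma flow_meas: "t \<in> {0..1} \<Longrightarrow> X t \<in> measurable M (borel_on \<Omega>)"
  using flow sets_M by (auto simp: is_flow_def cong: measurable_cong_sets)

lemma flow_mem: "t \<in> {0..1} \<Longrightarrow> x \<in> \<Omega> \<Longrightarrow> X t x \<in> \<Omega>"
  using measurable_space[OF flow_meas, of t x] by (simp add: space_M space_restrict_space)

lemma flow_deriv: "x \<in> \<Omega> \<Longrightarrow> t \<in> {0..1} \<Longrightarrow>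
    ((\<lambda>s. X s x) has_vector_derivative v t (X t x)) (at t within {0..1})"
  using flow by (auto simp: is_flow_def)

lemma flow_cont: "x \<in> \<Omega> \<Longrightarrow> continuous_on {0..1} (\<lambda>s. X s x)"
  by (rule continuous_on_vector_derivative) (rule flow_deriv)

text \<open>The flow is the limit of its piecewise constant interpolations in time.\<close>

lemma flow_pair_measurable:
  "(\<lambda>p. X (snd p) (fst p)) \<in> borel_measurable (restrict_space (M \<Otimes>\<^sub>M borel) (UNIV \<times> {0..1}))"
proof -
  let ?R = "restrict_space (M \<Otimes>\<^sub>M borel :: ('a \<times> real) measure) (UNIV \<times> {0..1})"
  \<comment> \<open>The time \<open>t\<close> rounded down to the grid of mesh 1/(n+1).\<close>
  define s where "s n t = real (nat \<lfloor>real (Suc n) * t\<rfloor>) / real (Suc n)" for n t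
  have space_R: "space ?R = \<Omega> \<times> {0..1}"
    by (auto simp: space_restrict_space space_pair_measure space_M)
  have fst_R: "fst \<in> measurable ?R M" and snd_R[measurable]: "snd \<in> borel_measurable ?R"
    by (auto intro: measurable_restrict_space1)
  have le: "nat \<lfloor>real (Suc n) * t\<rfloor> \<le> Suc n" if "t \<in> {0..1}" for n and t :: real
  proof -
    have "real (Suc n) * t \<le> real (Suc n) * 1" using that by (intro mult_left_mono) auto
    also have "\<dots> < real (Suc n) + 1" by simp
    finally have "\<lfloor>real (Suc n) * t\<rfloor> \<le> int (Suc n)"
      unfolding floor_le_iff of_int_of_nat_eq .
    then show ?thesis by linarith
  qed
  have s01: "s n t \<in> {0..1}" if "t \<in> {0..1}" for n t
    using le[OF that, of n] by (simp add: s_def divide_le_eq)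
  have s_lim: "(\<lambda>n. s n t) \<longlonglongrightarrow> t" if t: "t \<in> {0..1}" for t
  proof (rule tendsto_sandwich)
    have *: "real (Suc n) * t - 1 \<le> real (nat \<lfloor>real (Suc n) * t\<rfloor>)" "real (nat \<lfloor>real (Suc n) * t\<rfloor>) \<le> real (Suc n) * t" for n
      using t by (auto simp: of_nat_nat intro: of_int_floor_le)
    show "\<forall>\<^sub>F n in sequentially. t - inverse (real (Suc n)) \<le> s n t"
    proof (intro always_eventually allI)
      fix n
      have "t - inverse (real (Suc n)) = (real (Suc n) * t - 1) / real (Suc n)"
        by (simp add: field_simps del: of_nat_Suc)
      also have "\<dots> \<le> s n t" unfolding s_def by (intro divide_right_mono *) auto
      finally show "t - inverse (real (Suc n)) \<le> s n t" .
    qed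
    show "\<forall>\<^sub>F n in sequentially. s n t \<le> t"
    proof (intro always_eventually allI)
      fix n
      have "s n t \<le> (real (Suc n) * t) / real (Suc n)" unfolding s_def by (intro divide_right_mono *) auto
      then show "s n t \<le> t" by (simp del: of_nat_Suc)
    qed
    show "(\<lambda>n. t - inverse (real (Suc n))) \<longlonglongrightarrow> t"
      using tendsto_diff[OF tendsto_const LIMSEQ_inverse_real_of_nat, of t] by simp
  qed auto
  show ?thesis
  proof (rule borel_measurable_LIMSEQ_metric)
    fix n
    \<comment> \<open>For fixed \<open>n\<close> only finitely many grid times occur, and the flow
      map at each is measurable. The index runs up to and including \<open>Suc n\<close>, which is
      attained at time 1.\<close>
    have "(\<lambda>p. (\<lambda>i p. X (real i / real (Suc n)) (fst p)) (nat \<lfloor>real (Suc n) * snd p\<rfloor>) p) \<in> borel_measurable ?R"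
    proof (rule measurable_compose_countable'[where I="{..Suc n}"
          and f="\<lambda>i p. X (real i / real (Suc n)) (fst p)" and g="\<lambda>p. nat \<lfloor>real (Suc n) * snd p\<rfloor>"])
      fix i assume "i \<in> {..Suc n}"
      then have "real i / real (Suc n) \<in> {0..1}" by (simp add: divide_le_eq)
      then have "X (real i / real (Suc n)) \<in> borel_measurable M"
        using flow_meas measurable_restrict_space2_iff by blast
      with fst_R show "(\<lambda>p. X (real i / real (Suc n)) (fst p)) \<in> borel_measurable ?R"
        by (rule measurable_compose)
    next
      have "(\<lambda>p. nat \<lfloor>real (Suc n) * snd p\<rfloor>) \<in> measurable ?R (count_space UNIV)"
        by measurable
      from measurable_sets[OF this] show "(\<lambda>p. nat \<lfloor>real (Suc n) * snd p\<rfloor>) \<in> measurable ?R (count_space {..Suc n})"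
        using le[of _ n] by (subst measurable_count_space_eq2) (auto simp: space_R simp del: of_nat_Suc)
    qed auto
    then show "(\<lambda>p. X (s n (snd p)) (fst p)) \<in> borel_measurable ?R" by (simp add: s_def)
  next
    fix p assume "p \<in> space ?R"
    then have x: "fst p \<in> \<Omega>" and t: "snd p \<in> {0..1}" by (auto simp: space_R)
    show "(\<lambda>n. X (s n (snd p)) (fst p)) \<longlonglongrightarrow> X (snd p) (fst p)"
      by (rule continuous_on_tendsto_compose[OF flow_cont[OF x] s_lim[OF t] t]) (use s01[OF t] in auto)
  qed
qed

text \<open>The fields are measurable only on [0,1] \<times> \<Omega>, so the composition is formed
  on the restricted product space and extended by zero through the indicator.\<close>

lemma along_flow_measurable:
  fixes h :: "real \<times> 'a \<Rightarrow> 'b::real_normed_vector"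
  assumes h: "h \<in> borel_measurable (borel_on ({0..1} \<times> \<Omega>))"
  shows "(\<lambda>(x, t). indicator {0..1} t *\<^sub>R h (t, X t x)) \<in> borel_measurable (M \<Otimes>\<^sub>M borel)"
proof -
  let ?R = "restrict_space (M \<Otimes>\<^sub>M borel :: ('a \<times> real) measure) (UNIV \<times> {0..1})"
  have space_R: "space ?R = \<Omega> \<times> {0..1}"
    by (auto simp: space_restrict_space space_pair_measure space_M)
  have "snd \<in> borel_measurable ?R" by (auto intro: measurable_restrict_space1)
  then have "(\<lambda>p. (snd p, X (snd p) (fst p))) \<in> measurable ?R (borel_on ({0..1} \<times> \<Omega>))"
    by (intro measurable_restrict_space2 borel_measurable_Pair flow_pair_measurable)
      (auto simp: space_R flow_mem)
  then have "(\<lambda>p. h (snd p, X (snd p) (fst p))) \<in> borel_measurable ?R"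
    using h by (rule measurable_compose)
  moreover have "(UNIV \<times> {0..1}) \<inter> space (M \<Otimes>\<^sub>M borel :: ('a \<times> real) measure) = space M \<times> {0..1}"
    by (auto simp: space_pair_measure)
  ultimately have "(\<lambda>p. indicator (UNIV \<times> {0..1}) p *\<^sub>R h (snd p, X (snd p) (fst p))) \<in> borel_measurable (M \<Otimes>\<^sub>M borel)"
    by (subst (asm) borel_measurable_restrict_space_iff) auto
  moreover have "(\<lambda>p. indicator (UNIV \<times> {0..1}) p *\<^sub>R h (snd p, X (snd p) (fst p))) = (\<lambda>(x, t). indicator {0..1} t *\<^sub>R h (t, X t x))"
    by (auto simp: fun_eq_iff indicator_def)
  ultimately show ?thesis by simp
qed

section \<open>Growth rate and mass factor along a trajectory\<close>

definition rate :: "'a \<Rightarrow> real \<Rightarrow> real" where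
  "rate x t = indicator {0<..<1} t * \<beta> t (X t x)"

text \<open>This is the factor \<open>m\<^sub>t(x)\<close>. The constant 4 arises from squaring the
  growth factor, whose exponent carries a 2, and agrees with the reaction coefficient of the
  equation.\<close>

definition mass :: "'a \<Rightarrow> real \<Rightarrow> real" where
  "mass x = expint 4 (rate x)"

lemma rate_measurable: "(\<lambda>(x, t). rate x t) \<in> borel_measurable (M \<Otimes>\<^sub>M borel)"
proof -
  have "(\<lambda>(t, x). \<beta> t x) \<in> borel_measurable (borel_on ({0..1} \<times> \<Omega>))"
    using fields by (simp add: borel_fields_def)
  note [measurable] = along_flow_measurable[OF this]
  have "(\<lambda>p. indicator {0<..<1} (snd p) * (\<lambda>(x, t). indicator {0..1} t *\<^sub>R (case (t, X t x) of (t, x) \<Rightarrow> \<beta> t x)) p)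
      \<in> borel_measurable (M \<Otimes>\<^sub>M borel)"
    by measurable
  also have "(\<lambda>p. indicator {0<..<1} (snd p) * (\<lambda>(x, t). indicator {0..1} t *\<^sub>R (case (t, X t x) of (t, x) \<Rightarrow> \<beta> t x)) p)
      = (\<lambda>(x, t). rate x t)"
    by (auto simp: rate_def fun_eq_iff indicator_def)
  finally show ?thesis .
qed

lemma rate_integrable: "AE x in M. integrable lborel (rate x)"
  using L1 by eventually_elim (simp add: set_integrable_def rate_def[abs_def])

lemma rate_le: "x \<in> \<Omega> \<Longrightarrow> rate x t \<le> K * indicator {0<..<1} t"
  using K flow_mem[of t x] by (auto simp: rate_def indicator_def)

lemma mass_pos: "mass x t > 0"
  by (simp add: mass_def expint_def)

lemma mass_le:
  assumes x: "x \<in> \<Omega>"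
  shows "mass x t \<le> exp (4 * K)"
proof -
  have "(\<integral>s. indicator {0..t} s * rate x s \<partial>lborel) \<le> K"
  proof -
    \<comment> \<open>The comparison tolerates a non-integrable left integrand, whose integral is 0
      by convention, because the majorant is nonnegative. The bound thus holds at every point of
      \<Omega>, not just almost everywhere.\<close>
    have "(\<integral>s. indicator {0..t} s * rate x s \<partial>lborel) \<le> (\<integral>s. K * indicator {0<..<1::real} s \<partial>lborel)"
    proof (rule integral_mono')
      show "integrable lborel (\<lambda>s. K * indicator {0<..<1::real} s)"
        by (rule integrable_mult_right, rule integrable_real_indicator) auto
      show "indicator {0..t} s * rate x s \<le> K * indicator {0<..<1} s" for s
        using rate_le[OF x, of s] K(2) by (auto simp: indicator_def split: if_splits)
    qed (use K(2) in auto)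
    then show ?thesis by simp
  qed
  then show ?thesis by (simp add: mass_def expint_def)
qed

lemma mass_measurable: "(\<lambda>(x, t). mass x t) \<in> borel_measurable (M \<Otimes>\<^sub>M borel)"
proof -
  note [measurable] = rate_measurable
  have "(\<lambda>q. indicator {0..snd (fst q)} (snd q) * rate (fst (fst q)) (snd q)) =
     (\<lambda>q. (if 0 \<le> snd q \<and> snd q \<le> snd (fst q) then 1 else 0) * (\<lambda>(x, t). rate x t) (fst (fst q), snd q))"
    by (auto simp: indicator_def)
  also have "\<dots> \<in> borel_measurable ((M \<Otimes>\<^sub>M borel) \<Otimes>\<^sub>M lborel)"
    by measurable
  finally have "(\<lambda>p. \<integral>s. indicator {0..snd p} s * rate (fst p) s \<partial>lborel) \<in> borel_measurable (M \<Otimes>\<^sub>M borel)"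
    by (intro lborel.borel_measurable_lebesgue_integral) (simp add: case_prod_unfold)
  then show ?thesis unfolding mass_def expint_def by (simp add: case_prod_unfold)
qed

lemma mass_cont:
  assumes "integrable lborel (rate x)"
  shows "continuous_on {0..1} (mass x)"
proof -
  have si: "set_integrable lborel {0..t} (rate x)" for t
    using assms unfolding set_integrable_def by (intro integrable_mult_indicator) auto
  have eq: "mass x t = exp (4 * integral {0..t} (rate x))" for t
    using set_borel_integral_eq_integral(2)[OF si, of t]
    by (simp add: mass_def expint_def set_lebesgue_integral_def)
  show ?thesis
    unfolding eq[abs_def]
    by (intro continuous_intros indefinite_integral_continuous_1 set_borel_integral_eq_integral(1) si)
qed

lemma mass_growth:
  assumes \<rho>: "growth_factor \<Omega> M X \<beta> t \<rho>" and t: "t \<in> {0..1}"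
  shows "AE x in M. (\<rho> (X t x))\<^sup>2 = mass x t"
proof -
  \<comment> \<open>\<open>rate\<close> is cut off to the open interval, so the integrands can
    differ only at the times 0 and 1.\<close>
  have "(LBINT s:{0..t}. \<beta> s (X s x)) = (\<integral>s. indicator {0..t} s * rate x s \<partial>lborel)" for x
    unfolding set_lebesgue_integral_def
    by (rule integral_discrete_difference[where X="{0, 1}"]) (use t in \<open>auto simp: rate_def indicator_def\<close>)
  then have "(exp (2 * (LBINT s:{0..t}. \<beta> s (X s x))))\<^sup>2 = mass x t" for x
    by (simp add: mass_def expint_def power2_eq_square flip: exp_add)
  then show ?thesis
    using \<rho> unfolding growth_factor_def by (auto elim!: eventually_mono)
qed

text \<open>Write b for the rate and m for the mass. Since b is at most \<open>K\<close> on (0,1)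
  and \<open>K\<close> is nonnegative, |b| is at most 2K - b there. The term 2Km contributes at most
  \<open>2 * K * exp (4 * K)\<close>, and the integral of -bm is (1 - m(1))/4, at most 1/4. The
  bound does not depend on x, although the integrals of |b| over trajectories have no common bound
  by assumption.\<close>

lemma rate_mass_bound:
  assumes x: "x \<in> \<Omega>" and int: "integrable lborel (rate x)"
  shows "integrable lborel (\<lambda>t. \<bar>rate x t\<bar> * mass x t)"
    and "(\<integral>t. \<bar>rate x t\<bar> * mass x t \<partial>lborel) \<le> 2 * K * exp (4 * K) + 1 / 4"
proof -
  have [measurable]: "rate x \<in> borel_measurable lborel" "mass x \<in> borel_measurable lborel"
    using int by (auto simp: mass_def intro: expint_measurable)
  show int': "integrable lborel (\<lambda>t. \<bar>rate x t\<bar> * mass x t)"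
    by (rule Bochner_Integration.integrable_bound[of _ "\<lambda>t. exp (4 * K) * rate x t"])
      (use int mass_le[OF x] mass_pos less_imp_le[OF mass_pos] in
        \<open>auto simp: abs_mult mult.commute[of "mass x _"] mult.commute[of _ "\<bar>rate x _\<bar>"] intro!: mult_left_mono\<close>)
  have int'': "integrable lborel (\<lambda>t. rate x t * mass x t)"
    by (rule Bochner_Integration.integrable_bound[OF int']) (auto simp: abs_mult)
  \<comment> \<open>With the constant \<open>u = 1\<close> the fundamental theorem becomes the mass
    balance.\<close>
  have one: "expint_deriv (\<lambda>_. 1) (\<lambda>_. 0) 4 (rate x) = (\<lambda>t. 4 * (rate x t * mass x t))"
    by (auto simp: expint_deriv_def fun_eq_iff rate_def mass_def indicator_def)
  have "(\<integral>t. 4 * (rate x t * mass x t) \<partial>lborel) = mass x 1 - 1"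
    using integral_expint_deriv[of "\<lambda>_. 1" "\<lambda>_. 0" 0 "rate x" 4] int unfolding one
    by (simp add: mass_def)
  then have neg: "- (\<integral>t. rate x t * mass x t \<partial>lborel) \<le> 1 / 4"
    using mass_pos[of x 1] by simp
  have i1: "integrable lborel (\<lambda>t. 2 * K * exp (4 * K) * indicator {0<..<1::real} t)"
    by (rule integrable_mult_right, rule integrable_real_indicator) auto
  have "(\<integral>t. \<bar>rate x t\<bar> * mass x t \<partial>lborel)
      \<le> (\<integral>t. 2 * K * exp (4 * K) * indicator {0<..<1} t - rate x t * mass x t \<partial>lborel)"
  proof (intro Bochner_Integration.integral_mono int' Bochner_Integration.integrable_diff i1 int'')
    fix t
    have "\<bar>rate x t\<bar> \<le> 2 * (K * indicator {0<..<1} t) - rate x t"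
      using rate_le[OF x, of t] K(2) by (auto simp: indicator_def)
    then have "\<bar>rate x t\<bar> * mass x t \<le> (2 * (K * indicator {0<..<1} t) - rate x t) * mass x t"
      using mass_pos[of x t] by (intro mult_right_mono) auto
    also have "\<dots> \<le> 2 * K * indicator {0<..<1} t * exp (4 * K) - rate x t * mass x t"
      using mult_left_mono[OF mass_le[OF x, of t], of "2 * K * indicator {0<..<1} t"] K(2)
      by (simp add: algebra_simps)
    finally show "\<bar>rate x t\<bar> * mass x t \<le> 2 * K * exp (4 * K) * indicator {0<..<1} t - rate x t * mass x t"
      by (simp add: mult_ac)
  qed
  also have "\<dots> = 2 * K * exp (4 * K) - (\<integral>t. rate x t * mass x t \<partial>lborel)"
    by (subst Bochner_Integration.integral_diff[OF i1 int'']) simp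
  also have "\<dots> \<le> 2 * K * exp (4 * K) + 1 / 4" using neg by simp
  finally show "(\<integral>t. \<bar>rate x t\<bar> * mass x t \<partial>lborel) \<le> 2 * K * exp (4 * K) + 1 / 4" .
qed

section \<open>The equation tested along trajectories\<close>

lemma cre_integrand_measurable:
  assumes "C1 \<phi>"
  shows "(\<lambda>(t, x). cre_integrand v \<beta> \<phi> t x) \<in> borel_measurable (borel_on ({0..1} \<times> \<Omega>))"
proof -
  obtain p q where c: "continuous_on UNIV p" "continuous_on UNIV q"
    and pq: "\<And>t x. deriv (\<lambda>s. \<phi> (s, x)) t = p (t, x)" "\<And>t x. grad (\<lambda>y. \<phi> (t, y)) x = q (t, x)"
    by (rule C1_partials[OF assms]) blast
  with C1_continuous[OF assms] have [measurable]: "p \<in> borel_measurable (borel_on ({0..1} \<times> \<Omega>))"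
      "q \<in> borel_measurable (borel_on ({0..1} \<times> \<Omega>))" "\<phi> \<in> borel_measurable (borel_on ({0..1} \<times> \<Omega>))"
    by (auto intro!: measurable_restrict_space1 borel_measurable_continuous_onI)
  have [measurable]: "(\<lambda>z. v (fst z) (snd z)) \<in> borel_measurable (borel_on ({0..1} \<times> \<Omega>))"
      "(\<lambda>z. \<beta> (fst z) (snd z)) \<in> borel_measurable (borel_on ({0..1} \<times> \<Omega>))"
    using fields by (simp_all add: borel_fields_def case_prod_unfold)
  show ?thesis
    unfolding cre_integrand_def pq case_prod_unfold prod.collapse by measurable
qed

text \<open>The integral vanishes trajectory by trajectory. Integrability on the product follows
  because the slices have a common bound on their \<open>L\<^sup>1\<close> norms and
  \<open>M\<close> is finite.\<close>

lemma weak_formulation: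
  assumes \<phi>: "test_function \<Omega> \<phi>"
  defines "f \<equiv> \<lambda>x t. indicator {0<..<1} t * (cre_integrand v \<beta> \<phi> t (X t x) * mass x t)"
  shows "integrable (M \<Otimes>\<^sub>M lborel) (\<lambda>(x, t). f x t)"
    and "AE x in M. (\<integral>t. f x t \<partial>lborel) = 0"
proof -
  have C1: "C1 \<phi>" using \<phi> by (simp add: test_function_def)
  obtain p q where c: "continuous_on UNIV p" "continuous_on UNIV q"
    and pq: "\<And>t x. deriv (\<lambda>s. \<phi> (s, x)) t = p (t, x)" "\<And>t x. grad (\<lambda>y. \<phi> (t, y)) x = q (t, x)"
    and d: "\<And>t x. (\<phi> has_derivative (\<lambda>(s, h). s * p (t, x) + inner (q (t, x)) h)) (at (t, x))"
    by (rule C1_partials[OF C1]) blast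
  have c\<phi>: "continuous_on UNIV \<phi>" by (rule C1_continuous[OF C1])
  have bdd: "\<exists>B\<ge>0. \<forall>t\<in>{0..1}. \<forall>x\<in>\<Omega>. norm (g (t, x)) \<le> B"
    if "continuous_on UNIV g" for g :: "real \<times> 'a \<Rightarrow> 'c::real_normed_vector"
  proof -
    have "compact (g ` ({0..1} \<times> \<Omega>))"
      using that by (intro compact_continuous_image compact_Times compact) (auto intro: continuous_on_subset)
    then obtain B where "\<forall>y\<in>g ` ({0..1} \<times> \<Omega>). norm y \<le> B"
      by (meson bounded_iff compact_imp_bounded)
    then show ?thesis by (intro exI[of _ "max B 0"]) force
  qed
  obtain P Q F where P: "\<And>t x. t \<in> {0..1} \<Longrightarrow> x \<in> \<Omega> \<Longrightarrow> \<bar>p (t, x)\<bar> \<le> P"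
    and Q: "Q \<ge> 0" "\<And>t x. t \<in> {0..1} \<Longrightarrow> x \<in> \<Omega> \<Longrightarrow> norm (q (t, x)) \<le> Q"
    and F: "F \<ge> 0" "\<And>t x. t \<in> {0..1} \<Longrightarrow> x \<in> \<Omega> \<Longrightarrow> \<bar>\<phi> (t, x)\<bar> \<le> F"
    using bdd[OF c(1)] bdd[OF c(2)] bdd[OF c\<phi>] by (metis real_norm_def)
  \<comment> \<open>Bounds the derivative of \<phi> along a trajectory: \<open>P\<close> is for the
    time derivative, \<open>Q\<close> for the gradient, \<open>V\<close> for the velocity.\<close>
  define L where "L = P + Q * V"
  have transport: "\<bar>p (t, x) + inner (q (t, x)) (v t x)\<bar> \<le> L" if "t \<in> {0..1}" "x \<in> \<Omega>" for t x
  proof -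
    have "\<bar>inner (q (t, x)) (v t x)\<bar> \<le> norm (q (t, x)) * norm (v t x)" by (rule Cauchy_Schwarz_ineq2)
    also have "\<dots> \<le> Q * V" using Q V that by (intro mult_mono) auto
    finally show ?thesis using P[OF that] unfolding L_def by linarith
  qed
  \<comment> \<open>The definition of a test function speaks of the open time interval only, so the
    end times need continuity: a nonzero value there would persist at nearby interior times, which
    can be chosen outside the closed set \<open>S\<close> since the end point itself lies outside
    it.\<close>
  have vanish: "\<phi> (t, x) = 0" if t: "t \<in> {0, 1}" and x: "x \<in> \<Omega>" for t x
  proof (rule ccontr)
    assume ne: "\<phi> (t, x) \<noteq> 0"
    obtain S where S: "compact S" "S \<subseteq> {0<..<1} \<times> \<Omega>" "\<forall>z\<in>{0<..<1} \<times> \<Omega> - S. \<phi> z = 0"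
      using \<phi> unfolding test_function_def by auto
    define W where "W = (\<lambda>s. (s, x)) -` ({z. \<phi> z \<noteq> 0} \<inter> - S)"
    have "open {z. \<phi> z \<noteq> 0}"
      using continuous_on_open_vimage[OF open_UNIV, of \<phi>] c\<phi> by (force simp: vimage_def)
    then have "open ({z. \<phi> z \<noteq> 0} \<inter> - S)" using S(1) by (auto intro: compact_imp_closed)
    then have "open W" unfolding W_def by (intro open_vimage continuous_intros) auto
    moreover have "t \<in> W" using ne S(2) t by (auto simp: W_def)
    moreover have "t \<in> closure {0<..<1}" using t by auto
    ultimately have "W \<inter> {0<..<1} \<noteq> {}"
      using open_Int_closure_eq_empty[of W "{0<..<1}"] by blast
    then show False using S(3) x by (auto simp: W_def)
  qed
  note [measurable] = along_flow_measurable[OF cre_integrand_measurable[OF C1]] mass_measurable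
  have "(\<lambda>z. indicator {0<..<1} (snd z) * ((\<lambda>(x, t). indicator {0..1} t *\<^sub>R (case (t, X t x) of (t, x) \<Rightarrow> cre_integrand v \<beta> \<phi> t x)) z
      * (\<lambda>(x, t). mass x t) z)) \<in> borel_measurable (M \<Otimes>\<^sub>M borel)"
    by measurable
  also have "(\<lambda>z. indicator {0<..<1} (snd z) * ((\<lambda>(x, t). indicator {0..1} t *\<^sub>R (case (t, X t x) of (t, x) \<Rightarrow> cre_integrand v \<beta> \<phi> t x)) z
      * (\<lambda>(x, t). mass x t) z)) = (\<lambda>(x, t). f x t)"
    by (auto simp: fun_eq_iff f_def indicator_def)
  finally have fm[measurable]: "(\<lambda>(x, t). f x t) \<in> borel_measurable (M \<Otimes>\<^sub>M lborel)"
    by (simp cong: measurable_cong_sets)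
  have vm: "(\<lambda>t. indicator {0..1} t * (p (t, X t x) + inner (q (t, X t x)) (v t (X t x)))) \<in> borel_measurable borel"
    if x: "x \<in> \<Omega>" for x
  proof -
    have "(\<lambda>z. p z + inner (q z) (v (fst z) (snd z))) \<in> borel_measurable (borel_on ({0..1} \<times> \<Omega>))"
    proof -
      have [measurable]: "p \<in> borel_measurable (borel_on ({0..1} \<times> \<Omega>))"
          "q \<in> borel_measurable (borel_on ({0..1} \<times> \<Omega>))"
        using c by (auto intro!: measurable_restrict_space1 borel_measurable_continuous_onI)
      have [measurable]: "(\<lambda>z. v (fst z) (snd z)) \<in> borel_measurable (borel_on ({0..1} \<times> \<Omega>))"
        using fields by (simp add: borel_fields_def case_prod_unfold)
      show ?thesis by measurable
    qed
    from along_flow_measurable[OF this] measurable_compose[OF measurable_Pair1'[of x M borel]] x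
    show ?thesis by (auto simp: space_M o_def)
  qed
  \<comment> \<open>The first term bounds the transport part over the unit time interval, the second
    the reaction part through \<open>rate_mass_bound\<close>.\<close>
  let ?B = "L * exp (4 * K) + 4 * F * (2 * K * exp (4 * K) + 1 / 4)"
  have slice: "integrable lborel (f x) \<and> (\<integral>t. \<bar>f x t\<bar> \<partial>lborel) \<le> ?B \<and> (\<integral>t. f x t \<partial>lborel) = 0"
    if x: "x \<in> \<Omega>" and rx: "integrable lborel (rate x)" for x
  proof -
    let ?u = "\<lambda>t. \<phi> (t, X t x)" and ?u' = "\<lambda>t. p (t, X t x) + inner (q (t, X t x)) (v t (X t x))"
    have X01: "X t x \<in> \<Omega>" if "t \<in> {0..1}" for t using flow_mem that x by blast
    have du: "(?u has_vector_derivative ?u' t) (at t within {0..1})" if t: "t \<in> {0..1}" for t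
    proof -
      have "((\<lambda>t. (t, X t x)) has_derivative (\<lambda>h. (h, h *\<^sub>R v t (X t x)))) (at t within {0..1})"
        using flow_deriv[OF x t] unfolding has_vector_derivative_def by (intro derivative_intros)
      from has_derivative_compose[OF this d] show ?thesis
        by (simp add: has_vector_derivative_def algebra_simps)
    qed
    have L: "\<bar>?u' t\<bar> \<le> L" if "t \<in> {0..1}" for t using transport X01 that by blast
    note deriv = du vm[OF x] L
    \<comment> \<open>\<open>f\<close> is cut off to the open interval and
      \<open>expint_deriv\<close> to the closed one; the two exceptional times form a null
      set.\<close>
    have same: "f x t = expint_deriv ?u ?u' 4 (rate x) t" if "t \<notin> {0, 1}" for t
      using that by (auto simp: f_def expint_deriv_def cre_integrand_def pq mass_def rate_def indicator_def algebra_simps)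
    have int: "integrable lborel (f x)"
      using expint_deriv_integrable[OF deriv rx, of 4]
      by (subst integrable_discrete_difference[where X="{0, 1}" and g="expint_deriv ?u ?u' 4 (rate x)"])
        (use same in auto)
    have "(\<integral>t. f x t \<partial>lborel) = (\<integral>t. expint_deriv ?u ?u' 4 (rate x) t \<partial>lborel)"
      by (rule integral_discrete_difference[where X="{0, 1}"]) (use same in auto)
    also have "\<dots> = 0"
      using integral_expint_deriv[OF deriv rx, of 4] vanish X01 by simp
    finally have zero: "(\<integral>t. f x t \<partial>lborel) = 0" .
    have i1: "integrable lborel (\<lambda>t. L * exp (4 * K) * indicator {0<..<1::real} t)"
      by (rule integrable_mult_right, rule integrable_real_indicator) auto
    note i2 = rate_mass_bound[OF x rx]
    have "(\<integral>t. \<bar>f x t\<bar> \<partial>lborel) \<le> (\<integral>t. L * exp (4 * K) * indicator {0<..<1} t + 4 * F * (\<bar>rate x t\<bar> * mass x t) \<partial>lborel)"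
    proof (rule integral_mono)
      show "integrable lborel (\<lambda>t. L * exp (4 * K) * indicator {0<..<1} t + 4 * F * (\<bar>rate x t\<bar> * mass x t))"
        by (intro Bochner_Integration.integrable_add i1 integrable_mult_right i2)
      fix t
      show "\<bar>f x t\<bar> \<le> L * exp (4 * K) * indicator {0<..<1} t + 4 * F * (\<bar>rate x t\<bar> * mass x t)"
      proof (cases "t \<in> {0<..<1}")
        case True
        then have t: "t \<in> {0..1}" by auto
        have "f x t = (?u' t + 4 * ?u t * rate x t) * mass x t"
          using True by (simp add: f_def cre_integrand_def pq rate_def algebra_simps)
        then have "\<bar>f x t\<bar> = \<bar>?u' t + 4 * ?u t * rate x t\<bar> * mass x t"
          using mass_pos[of x t] by (simp add: abs_mult)
        also have "\<dots> \<le> (L + 4 * F * \<bar>rate x t\<bar>) * mass x t"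
        proof (rule mult_right_mono)
          have "\<bar>4 * ?u t * rate x t\<bar> \<le> 4 * F * \<bar>rate x t\<bar>"
            using F(2)[OF t X01[OF t]] by (simp add: abs_mult mult_right_mono)
          then show "\<bar>?u' t + 4 * ?u t * rate x t\<bar> \<le> L + 4 * F * \<bar>rate x t\<bar>"
            using L[OF t] by linarith
        qed (use mass_pos[of x t] in simp)
        also have "\<dots> \<le> L * exp (4 * K) + 4 * F * (\<bar>rate x t\<bar> * mass x t)"
          using mult_left_mono[OF mass_le[OF x, of t], of L] L[OF t] by (simp add: algebra_simps)
        finally show ?thesis using True by simp
      next
        case False
        then show ?thesis using F(1) mass_pos[of x t] by (simp add: f_def)
      qed
    qed (use int in auto)
    also have "\<dots> = L * exp (4 * K) + 4 * F * (\<integral>t. \<bar>rate x t\<bar> * mass x t \<partial>lborel)"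
      by (subst Bochner_Integration.integral_add) (use i1 i2 in auto)
    also have "\<dots> \<le> ?B" using i2(2) F(1) by (intro add_left_mono mult_left_mono) auto
    finally show ?thesis using int zero by blast
  qed
  have AE_slice: "AE x in M. integrable lborel (f x) \<and> (\<integral>t. \<bar>f x t\<bar> \<partial>lborel) \<le> ?B \<and> (\<integral>t. f x t \<partial>lborel) = 0"
    using rate_integrable AE_space by eventually_elim (use slice space_M in auto)
  then show "AE x in M. (\<integral>t. f x t \<partial>lborel) = 0" by auto
  show "integrable (M \<Otimes>\<^sub>M lborel) (\<lambda>(x, t). f x t)"
  proof (rule P.Fubini_integrable[OF fm])
    have [measurable]: "(\<lambda>x. \<integral>t. norm (f x t) \<partial>lborel) \<in> borel_measurable M"
      using fm by (intro lborel.borel_measurable_lebesgue_integral) (simp add: case_prod_unfold)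
    have "integrable M (\<lambda>x. \<integral>t. norm (f x t) \<partial>lborel)"
      by (rule M.integrable_const_bound[where B="?B"]) (use AE_slice in \<open>auto elim!: eventually_mono\<close>)
    then show "integrable M (\<lambda>x. \<integral>t. norm (case (x, t) of (x, t) \<Rightarrow> f x t) \<partial>lborel)" by simp
  qed (use AE_slice in auto)
qed

section \<open>The transported measures solve the equation\<close>

definition transported :: "(real \<Rightarrow> 'a \<Rightarrow> real) \<Rightarrow> real \<Rightarrow> 'a measure" where
  "transported \<rho> t = density (distr M (borel_on \<Omega>) (X t)) (\<lambda>y. ennreal ((\<rho> t y)\<^sup>2))"

context
  fixes \<rho> :: "real \<Rightarrow> 'a \<Rightarrow> real"
  assumes \<rho>: "\<And>t. t \<in> {0..1} \<Longrightarrow> growth_factor \<Omega> M X \<beta> t (\<rho> t)"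
begin

lemma factor_measurable: "t \<in> {0..1} \<Longrightarrow> \<rho> t \<in> borel_measurable (borel_on \<Omega>)"
  using \<rho> by (simp add: growth_factor_def)

lemma sets_transported: "sets (transported \<rho> t) = sets (borel_on \<Omega>)"
  by (simp add: transported_def)

text \<open>\<open>transported\<close> is defined in the form
  \<open>r\<^sub>t\<^sup>2 \<eta>\<^sub>t\<close> that the theorem asserts. Here it becomes the
  push-forward of the initial datum weighted by \<open>mass\<close>, the form in which the
  dependence on time can be studied along trajectories.\<close>

lemma nn_integral_transported:
  assumes t: "t \<in> {0..1}" and f: "f \<in> borel_measurable (borel_on \<Omega>)"
  shows "(\<integral>\<^sup>+y. f y \<partial>transported \<rho> t) = (\<integral>\<^sup>+x. ennreal (mass x t) * f (X t x) \<partial>M)"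
proof -
  note [measurable] = flow_meas[OF t] factor_measurable[OF t] f
  have "(\<integral>\<^sup>+y. f y \<partial>transported \<rho> t) = (\<integral>\<^sup>+x. ennreal ((\<rho> t (X t x))\<^sup>2) * f (X t x) \<partial>M)"
    unfolding transported_def by (simp add: nn_integral_density nn_integral_distr)
  also have "\<dots> = (\<integral>\<^sup>+x. ennreal (mass x t) * f (X t x) \<partial>M)"
    by (rule nn_integral_cong_AE) (use mass_growth[OF \<rho>[OF t] t] in \<open>auto elim!: eventually_mono\<close>)
  finally show ?thesis .
qed

lemma integral_transported:
  fixes f :: "'a \<Rightarrow> real"
  assumes t: "t \<in> {0..1}" and f: "f \<in> borel_measurable (borel_on \<Omega>)"
  shows "(\<integral>y. f y \<partial>transported \<rho> t) = (\<integral>x. mass x t * f (X t x) \<partial>M)"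
proof -
  note [measurable] = flow_meas[OF t] factor_measurable[OF t] f
  have [measurable]: "(\<lambda>x. mass x t) \<in> borel_measurable M"
    using measurable_compose[OF measurable_Pair2'[of t borel M] mass_measurable] by simp
  have "(\<integral>y. f y \<partial>transported \<rho> t) = (\<integral>x. (\<rho> t (X t x))\<^sup>2 * f (X t x) \<partial>M)"
    unfolding transported_def by (simp add: integral_density integral_distr)
  also have "\<dots> = (\<integral>x. mass x t * f (X t x) \<partial>M)"
    by (rule integral_cong_AE) (use mass_growth[OF \<rho>[OF t] t] in \<open>auto elim!: eventually_mono\<close>)
  finally show ?thesis .
qed

lemma finite_transported:
  assumes t: "t \<in> {0..1}"
  shows "finite_measure (transported \<rho> t)"
proof (rule finite_measureI)
  have "emeasure (transported \<rho> t) (space (transported \<rho> t)) = (\<integral>\<^sup>+x. ennreal (mass x t) \<partial>M)"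
    using nn_integral_transported[OF t, of "\<lambda>_. 1"] by simp
  also have "\<dots> \<le> (\<integral>\<^sup>+x. ennreal (exp (4 * K)) \<partial>M)"
    using mass_le by (intro nn_integral_mono) (auto simp: space_M)
  also have "\<dots> < \<infinity>" by (simp add: ennreal_mult_eq_top_iff less_top[symmetric])
  finally show "emeasure (transported \<rho> t) (space (transported \<rho> t)) \<noteq> \<infinity>" by auto
qed

text \<open>For almost every x both the mass and the trajectory are continuous in time, and the
  trajectory stays in \<Omega>, where the test function is continuous. The bound on the mass
  supplies a constant majorant.\<close>

lemma weakly_continuous_transported: "weakly_continuous \<Omega> (transported \<rho>)"
  unfolding weakly_continuous_def
proof (intro allI impI)
  fix f :: "'a \<Rightarrow> real"
  assume f: "continuous_on \<Omega> f" and "bounded (f ` \<Omega>)"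
  then obtain B where B: "\<And>x. x \<in> \<Omega> \<Longrightarrow> \<bar>f x\<bar> \<le> B" unfolding bounded_iff by auto
  have fm[measurable]: "f \<in> borel_measurable (borel_on \<Omega>)"
    by (rule borel_measurable_continuous_on_restrict[OF f])
  have mm[measurable]: "(\<lambda>x. mass x t) \<in> borel_measurable M" for t
    using measurable_compose[OF measurable_Pair2'[of t borel M] mass_measurable] by simp
  have "continuous_on {0..1} (\<lambda>t. \<integral>x. mass x t * f (X t x) \<partial>M)"
    unfolding continuous_on_sequentially
  proof (intro ballI allI impI)
    fix s :: "nat \<Rightarrow> real" and t
    assume t: "t \<in> {0..1}" and "(\<forall>n. s n \<in> {0..1}) \<and> s \<longlonglongrightarrow> t"
    then have s: "\<And>n. s n \<in> {0..1}" "s \<longlonglongrightarrow> t" by auto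
    show "((\<lambda>t. \<integral>x. mass x t * f (X t x) \<partial>M) \<circ> s) \<longlonglongrightarrow> (\<integral>x. mass x t * f (X t x) \<partial>M)"
      unfolding o_def
    proof (rule integral_dominated_convergence[where w="\<lambda>_. exp (4 * K) * B"])
      note [measurable] = flow_meas[OF t]
      show "(\<lambda>x. mass x t * f (X t x)) \<in> borel_measurable M" by measurable
      show "(\<lambda>x. mass x (s n) * f (X (s n) x)) \<in> borel_measurable M" for n
      proof -
        note [measurable] = flow_meas[OF s(1)[of n]]
        show ?thesis by measurable
      qed
      show "AE x in M. (\<lambda>n. mass x (s n) * f (X (s n) x)) \<longlonglongrightarrow> mass x t * f (X t x)"
        using rate_integrable AE_space
      proof eventually_elim
        fix x assume rx: "integrable lborel (rate x)" and "x \<in> space M"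
        then have x: "x \<in> \<Omega>" by (simp add: space_M)
        have "continuous_on {0..1} (\<lambda>t. mass x t * f (X t x))"
          by (intro continuous_on_mult mass_cont[OF rx] continuous_on_compose2[OF f flow_cont[OF x]])
            (use flow_mem x in auto)
        then show "(\<lambda>n. mass x (s n) * f (X (s n) x)) \<longlonglongrightarrow> mass x t * f (X t x)"
          by (rule continuous_on_tendsto_compose[OF _ s(2) t]) (use s(1) in auto)
      qed
      show "AE x in M. norm (mass x (s n) * f (X (s n) x)) \<le> exp (4 * K) * B" for n
      proof (rule AE_I2)
        fix x assume "x \<in> space M"
        then have x: "x \<in> \<Omega>" by (simp add: space_M)
        have "\<bar>mass x (s n)\<bar> \<le> exp (4 * K)" using mass_le[OF x, of "s n"] mass_pos[of x "s n"] by simp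
        then show "norm (mass x (s n) * f (X (s n) x)) \<le> exp (4 * K) * B"
          using B[OF flow_mem[OF s(1) x], of n] by (simp add: abs_mult mult_mono)
      qed
    qed auto
  qed
  then show "continuous_on {0..1} (\<lambda>t. \<integral>x. f x \<partial>transported \<rho> t)"
    by (rule continuous_on_eq) (simp add: integral_transported[OF _ fm])
qed

text \<open>Pulled back to trajectories, both requirements concern the function \<open>f\<close> on
  the product: Tonelli identifies the finiteness condition with its integrability, and Fubini
  reduces the equation to the vanishing time integrals.\<close>

lemma cre_distributional_transported: "cre_distributional \<Omega> (transported \<rho>) v \<beta>"
  unfolding cre_distributional_def
proof (intro allI impI)
  fix \<phi> assume \<phi>: "test_function \<Omega> \<phi>"
  define f where "f x t = indicator {0<..<1} t * (cre_integrand v \<beta> \<phi> t (X t x) * mass x t)" for x t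
  have f_int: "integrable (M \<Otimes>\<^sub>M lborel) (\<lambda>(x, t). f x t)"
    and f_zero: "AE x in M. (\<integral>t. f x t \<partial>lborel) = 0"
    using weak_formulation[OF \<phi>] unfolding f_def by auto
  have [measurable]: "(\<lambda>(x, t). f x t) \<in> borel_measurable (M \<Otimes>\<^sub>M lborel)" using f_int by auto
  have cm: "cre_integrand v \<beta> \<phi> t \<in> borel_measurable (borel_on \<Omega>)" if t: "t \<in> {0..1}" for t
  proof -
    have "(\<lambda>x. (t, x)) \<in> measurable (borel_on \<Omega>) (borel_on ({0..1} \<times> \<Omega>))"
      using t by (intro measurable_restrict_space3) auto
    from measurable_compose[OF this cre_integrand_measurable] \<phi> show ?thesis
      by (simp add: test_function_def)
  qed
  have "(\<integral>\<^sup>+t\<in>{0<..<1}. (\<integral>\<^sup>+x. ennreal \<bar>cre_integrand v \<beta> \<phi> t x\<bar> \<partial>transported \<rho> t) \<partial>lborel)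
      = (\<integral>\<^sup>+t. (\<integral>\<^sup>+x. ennreal (norm (f x t)) \<partial>M) \<partial>lborel)"
  proof (rule nn_integral_cong)
    fix t :: real
    show "(\<integral>\<^sup>+x. ennreal \<bar>cre_integrand v \<beta> \<phi> t x\<bar> \<partial>transported \<rho> t) * indicator {0<..<1} t
      = (\<integral>\<^sup>+x. ennreal (norm (f x t)) \<partial>M)"
    proof (cases "t \<in> {0<..<1}")
      case True
      then have t: "t \<in> {0..1}" by auto
      show ?thesis
        using True cm[OF t] mass_pos less_imp_le[OF mass_pos]
        by (subst nn_integral_transported[OF t])
          (auto intro!: nn_integral_cong simp: f_def abs_mult mult.commute simp flip: ennreal_mult)
    qed (simp add: f_def)
  qed
  also have "\<dots> = (\<integral>\<^sup>+z. ennreal (norm (case z of (x, t) \<Rightarrow> f x t)) \<partial>(M \<Otimes>\<^sub>M lborel))"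
    by (subst P.nn_integral_snd[symmetric]) auto
  also have "\<dots> < \<infinity>" using f_int unfolding integrable_iff_bounded by simp
  finally have fin: "(\<integral>\<^sup>+t\<in>{0<..<1}. (\<integral>\<^sup>+x. ennreal \<bar>cre_integrand v \<beta> \<phi> t x\<bar> \<partial>transported \<rho> t) \<partial>lborel) < \<infinity>" .
  have "(LBINT t:{0<..<1}. (\<integral>x. cre_integrand v \<beta> \<phi> t x \<partial>transported \<rho> t)) = (\<integral>t. (\<integral>x. f x t \<partial>M) \<partial>lborel)"
    unfolding set_lebesgue_integral_def
  proof (intro Bochner_Integration.integral_cong refl)
    fix t :: real
    show "indicator {0<..<1} t *\<^sub>R (\<integral>x. cre_integrand v \<beta> \<phi> t x \<partial>transported \<rho> t) = (\<integral>x. f x t \<partial>M)"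
    proof (cases "t \<in> {0<..<1}")
      case True
      then have t: "t \<in> {0..1}" by auto
      show ?thesis
        using True by (simp add: integral_transported[OF t cm[OF t]] f_def mult.commute)
    qed (simp add: f_def)
  qed
  also have "\<dots> = (\<integral>x. (\<integral>t. f x t \<partial>lborel) \<partial>M)"
    by (rule P.Fubini_integral[OF f_int])
  also have "\<dots> = 0"
    by (rule integral_eq_zero_AE[OF f_zero])
  finally show "(\<integral>\<^sup>+t\<in>{0<..<1}. (\<integral>\<^sup>+x. ennreal \<bar>cre_integrand v \<beta> \<phi> t x\<bar> \<partial>transported \<rho> t) \<partial>lborel) < \<infinity> \<and>
      (LBINT t:{0<..<1}. (\<integral>x. cre_integrand v \<beta> \<phi> t x \<partial>transported \<rho> t)) = 0"
    using fin by simp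
qed

lemma cre_solution_transported: "cre_solution \<Omega> (transported \<rho>) v \<beta>"
  unfolding cre_solution_def fin_radon_def
  using fields sets_transported finite_transported weakly_continuous_transported cre_distributional_transported
  by auto

lemma transported_0: "transported \<rho> 0 = M"
proof (rule measure_eqI)
  fix A assume "A \<in> sets (transported \<rho> 0)"
  then have A: "A \<in> sets (borel_on \<Omega>)" by (simp add: sets_transported)
  have X0: "X 0 x = x" if "x \<in> \<Omega>" for x using flow that by (simp add: is_flow_def)
  have m0: "mass x 0 = 1" for x
  proof -
    \<comment> \<open>The integrand vanishes identically, as \<open>rate\<close> is 0 at time
      0.\<close>
    have "(\<integral>s. indicator {0..0} s * rate x s \<partial>lborel) = 0"
      by (rule integral_eq_zero_AE) (auto simp: rate_def indicator_def intro!: AE_I2)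
    then show ?thesis by (simp add: mass_def expint_def)
  qed
  have "emeasure (transported \<rho> 0) A = (\<integral>\<^sup>+y. indicator A y \<partial>transported \<rho> 0)"
    using A by (simp add: sets_transported)
  also have "\<dots> = (\<integral>\<^sup>+x. indicator A x \<partial>M)"
    using A by (subst nn_integral_transported) (auto intro!: nn_integral_cong simp: m0 X0 space_M)
  also have "\<dots> = emeasure M A" using A by (simp add: sets_M)
  finally show "emeasure (transported \<rho> 0) A = emeasure M A" .
qed (simp add: sets_transported sets_M)

end
end


section \<open>Identification with the geodesic by uniqueness, and the resulting lift\<close>

theorem proposition3p10:
  fixes \<Omega> \<Gamma> :: "'a::euclidean_space set"
    and \<mu> \<eta> :: "real \<Rightarrow> 'a measure"
    and lam :: "real \<Rightarrow> ('a \<times> real) set measure"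
    and v X :: "real \<Rightarrow> 'a \<Rightarrow> 'a"
    and \<beta> r :: "real \<Rightarrow> 'a \<Rightarrow> real"
    and \<beta>\<^sub>m\<^sub>a\<^sub>x :: real
  assumes "compact \<Omega>"
    and "compactly_inside \<Gamma> (interior \<Omega>)"
    and solution: "cre_solution \<Omega> \<mu> v \<beta>"
    and unique: "\<And>\<nu>. cre_solution \<Omega> \<nu> v \<beta> \<Longrightarrow> \<nu> 0 = \<mu> 0 \<Longrightarrow> (\<forall>t\<in>{0..1}. \<nu> t = \<mu> t)"
    and geodesic: "HK_geodesic \<Omega> \<mu>"
    and supported: "\<forall>t\<in>{0..1}. \<mu> t \<in> fin_radon_supp \<Omega> \<Gamma>"
    and v_bounded: "\<exists>C. \<forall>t\<in>{0..1}. \<forall>x\<in>\<Omega>. norm (v t x) \<le> C"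
    and flow: "is_flow \<Omega> v X"
    and injective: "\<forall>t\<in>{0..1}. ae_injective (\<mu> 0) (X t)"
    and beta_L1: "AE x in \<mu> 0. set_integrable lborel {0<..<1} (\<lambda>s. \<beta> s (X s x))"
    and beta_max: "\<forall>s\<in>{0..1}. \<forall>x\<in>\<Omega>. \<beta> s x \<le> \<beta>\<^sub>m\<^sub>a\<^sub>x"
    and eta: "\<forall>t\<in>{0..1}. \<eta> t = distr (\<mu> 0) (borel_on \<Omega>) (X t)"
    and r: "\<forall>t\<in>{0..1}. growth_factor \<Omega> (\<mu> 0) X \<beta> t (r t)"
    and r_unique: "\<forall>t\<in>{0..1}. \<forall>\<rho>. growth_factor \<Omega> (\<mu> 0) X \<beta> t \<rho> \<longrightarrow> (AE y in \<eta> t. \<rho> y = r t y)"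
    and lam: "\<forall>t\<in>{0..1}. lam t = distr (\<eta> t) (cone_borel \<Omega>) (\<lambda>x. cone_pt \<Omega> (x, r t x))"
  shows "\<forall>t\<in>{0..1}.
           (\<forall>A. A \<in> sets borel \<longrightarrow> A \<subseteq> \<Omega> \<longrightarrow>
              emeasure (\<mu> t) A = (\<integral>\<^sup>+x\<in>A. ennreal ((r t x)\<^sup>2) \<partial>\<eta> t)) \<and>
           is_lift \<Omega> (lam t) (\<mu> t)"
proof (rule ballI)
  have solution_simps: "borel_fields \<Omega> v \<beta>" "\<mu> 0 \<in> fin_radon \<Omega>"
    using solution by (auto simp: cre_solution_def)
  obtain V where V: "\<forall>t\<in>{0..1}. \<forall>x\<in>\<Omega>. norm (v t x) \<le> V"
    using v_bounded by blast
  \<comment> \<open>The upper bound is replaced by its maximum with 0 because the constant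
    \<open>K\<close> must be nonnegative.\<close>
  interpret bounded_reaction_flow "\<mu> 0" \<Omega> v X \<beta> V "max \<beta>\<^sub>m\<^sub>a\<^sub>x 0"
    using \<open>compact \<Omega>\<close> solution_simps V flow beta_L1 beta_max
    by (intro bounded_reaction_flow.intro bounded_reaction_flow_axioms.intro)
      (auto simp: fin_radon_def le_max_iff_disj)
  have growth: "growth_factor \<Omega> (\<mu> 0) X \<beta> t (r t)" if "t \<in> {0..1}" for t
    using r that by blast
  have \<mu>_eq: "\<forall>t\<in>{0..1}. transported r t = \<mu> t"
    by (rule unique[OF cre_solution_transported[OF growth] transported_0[OF growth]])
  fix t :: real assume t: "t \<in> {0..1}"
  have \<eta>: "\<eta> t = distr (\<mu> 0) (borel_on \<Omega>) (X t)" using eta t by blast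
  have \<mu>: "\<mu> t = density (\<eta> t) (\<lambda>y. ennreal ((r t y)\<^sup>2))"
    using \<mu>_eq t by (simp add: \<eta> transported_def)
  have rm: "r t \<in> borel_measurable (borel_on \<Omega>)" and pos: "\<And>x. x \<in> \<Omega> \<Longrightarrow> r t x \<ge> 0"
    using growth[OF t] by (auto simp: growth_factor_def less_imp_le)
  have rm'[measurable]: "r t \<in> borel_measurable (\<eta> t)" using rm by (simp add: \<eta>)
  have \<Omega>: "\<Omega> \<in> sets borel" using \<open>compact \<Omega>\<close> by (simp add: borel_compact)
  \<comment> \<open>The total mass of \<open>\<mu> t\<close> is the integral of
    \<open>r\<^sub>t\<^sup>2\<close> against \<open>\<eta> t\<close>, so its finiteness is the
    second moment condition on the lift.\<close>
  have "finite_measure (\<mu> t)"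
    using finite_transported[OF growth t] \<mu>_eq t by simp
  then have "emeasure (\<mu> t) (space (\<mu> t)) < \<infinity>"
    by (simp add: finite_measure.emeasure_finite less_top[symmetric])
  then have "(\<integral>\<^sup>+x. ennreal ((r t x)\<^sup>2) \<partial>\<eta> t) < \<infinity>"
    by (simp add: \<mu> emeasure_density cong: nn_integral_cong)
  moreover have "finite_measure (\<eta> t)"
    unfolding \<eta> by (rule M.finite_measure_distr[OF flow_meas[OF t]])
  ultimately have "is_lift \<Omega> (distr (\<eta> t) (cone_borel \<Omega>) (\<lambda>x. cone_pt \<Omega> (x, r t x))) (\<mu> t)"
    unfolding \<mu> using is_lift_graph[OF \<Omega> _ _ rm pos, of "\<eta> t"] by (simp add: \<eta>)
  then have "is_lift \<Omega> (lam t) (\<mu> t)" using lam t by simp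
  moreover have "emeasure (\<mu> t) A = (\<integral>\<^sup>+x\<in>A. ennreal ((r t x)\<^sup>2) \<partial>\<eta> t)" if "A \<in> sets borel" "A \<subseteq> \<Omega>" for A
  proof -
    have "A \<in> sets (\<eta> t)" using that \<Omega> by (simp add: \<eta> sets_restrict_space_iff)
    then show ?thesis unfolding \<mu> by (subst emeasure_density) auto
  qed
  ultimately show "(\<forall>A. A \<in> sets borel \<longrightarrow> A \<subseteq> \<Omega> \<longrightarrow>
      emeasure (\<mu> t) A = (\<integral>\<^sup>+x\<in>A. ennreal ((r t x)\<^sup>2) \<partial>\<eta> t)) \<and> is_lift \<Omega> (lam t) (\<mu> t)"
    by blast
qed

end
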